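(* Let $\Pi$ be any LCL problem on graphs of constant maximum degree. If there is a randomized $\mathsf{LCA}$ algorithm that solves $\Pi$ with probe complexity $o(\sqrt{\log n})$, then there is also a deterministic $\mathsf{LCA}$ algorithm that solves $\Pi$ with probe complexity $O(\log^* n)$.
   Context: An LCL problem $\Pi$ on constant-degree graphs is a quadruple $(\Sigma_{in},\Sigma_{out},r,\mathcal{P})$ where $\Sigma_{in},\Sigma_{out}$ are finite sets, $r$ is a positive integer, and $\mathcal{P}$ is a finite collection of $\Sigma_{in}$-$\Sigma_{out}$-labeled graphs. A half-edge is a pair $(v,e)$ with $e$ an edge incident to $v$. A correct solution on a $\Sigma_{in}$-labeled graph $(G,f_{in})$ is a labeling $f_{out}$ of the half-edges of $G$ with elements of $\Sigma_{out}$ such that for every node $v$, the radius-$r$ ball $B_G(v,r)$ with the restrictions of $f_{in}, f_{out}$ is isomorphic to a member of $\mathcal{P}$. $\mathsf{LCA}$ model: the $n$-node input graph has unique IDs from $[n]$, a port numbering of each node's edges, and possibly local input labels. The algorithm must answer queries about the output of a given node/edge so that the answers to all queries together form a valid solution. To answer a query it may probe the graph; a probe consists of an ID $i\in[n]$ and a port number, and returns the local information of the neighbor of node $i$ through that port. The answer to a query may depend only on the input graph and (for randomized algorithms) a shared random bit string (stateless algorithm). The probe complexity is the maximum number of probes over all inputs and queries. A randomized $\mathsf{LCA}$ algorithm must produce a globally valid output with probability at least $1-1/n^{c}$ for any desired constant $c$; a deterministic one uses no randomness and must always be correct. *)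

theory Defs
  imports "HOL-Probability.Probability" "HOL-Library.Landau_Symbols"
begin

text \<open>A centered, half-edge-labelled graph (used for the finite collection P of an LCL).
  Vertices are naturals, edges are two-element vertex sets, a half-edge is a pair (a, e)
  with a in e. Labels are only meaningful on half-edges.\<close>
record ('i, 'o) lgraph =
  lverts  :: "nat set"
  ledges  :: "nat set set"
  lcenter :: nat
  lin     :: "nat \<Rightarrow> nat set \<Rightarrow> 'i"
  lout    :: "nat \<Rightarrow> nat set \<Rightarrow> 'o"

definition lg_iso :: "('i, 'o) lgraph \<Rightarrow> ('i, 'o) lgraph \<Rightarrow> bool" where
  "lg_iso H1 H2 \<longleftrightarrow> (\<exists>f. bij_betw f (lverts H1) (lverts H2)
      \<and> ledges H2 = (\<lambda>e. f ` e) ` ledges H1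
      \<and> f (lcenter H1) = lcenter H2
      \<and> (\<forall>a\<in>lverts H1. \<forall>e\<in>ledges H1. a \<in> e \<longrightarrow>
            lin H2 (f a) (f ` e) = lin H1 a e \<and> lout H2 (f a) (f ` e) = lout H1 a e))"

text \<open>An LCL problem (Sigma_in, Sigma_out, r, P) on graphs of maximum degree at most
  lcl_delta. Sigma_in and Sigma_out are the (finite) types 'i and 'o.\<close>
record ('i, 'o) lcl =
  lcl_delta :: nat
  lcl_r     :: nat
  lcl_P     :: "('i, 'o) lgraph set"

definition lcl_wf :: "('i::finite, 'o::finite) lcl \<Rightarrow> bool" where
  "lcl_wf L \<longleftrightarrow> lcl_r L \<ge> 1 \<and> finite (lcl_P L) \<and> (\<forall>H\<in>lcl_P L. finite (lverts H))"

text \<open>Nodes are 0..<gn, and the ID of a node is the node itself (IDs from [n]).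
  gnbr v p is the neighbour of v through port p (p < gdeg v); gin v p is the
  input label of half-edge (v, port p).\<close>
record 'i pgraph =
  gn   :: nat
  gdeg :: "nat \<Rightarrow> nat"
  gnbr :: "nat \<Rightarrow> nat \<Rightarrow> nat"
  gin  :: "nat \<Rightarrow> nat \<Rightarrow> 'i"

definition wf_pgraph :: "nat \<Rightarrow> 'i pgraph \<Rightarrow> bool" where
  "wf_pgraph \<Delta> G \<longleftrightarrow>
     (\<forall>v<gn G. gdeg G v \<le> \<Delta>)
   \<and> (\<forall>v<gn G. inj_on (gnbr G v) {..<gdeg G v})
   \<and> (\<forall>v<gn G. \<forall>p<gdeg G v. gnbr G v p < gn G \<and> gnbr G v p \<noteq> v
        \<and> (\<exists>q<gdeg G (gnbr G v p). gnbr G (gnbr G v p) q = v))"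

definition adj :: "'i pgraph \<Rightarrow> (nat \<times> nat) set" where
  "adj G = {(u, w). u < gn G \<and> (\<exists>p<gdeg G u. gnbr G u p = w)}"

definition port_of :: "'i pgraph \<Rightarrow> nat \<Rightarrow> nat set \<Rightarrow> nat" where
  "port_of G a e = (THE p. p < gdeg G a \<and> {a, gnbr G a p} = e)"

definition ball :: "'i pgraph \<Rightarrow> nat \<Rightarrow> nat \<Rightarrow> (nat \<Rightarrow> nat \<Rightarrow> 'o) \<Rightarrow> ('i, 'o) lgraph" where
  "ball G r v fout =
     (let V = {u. \<exists>k\<le>r. (v, u) \<in> adj G ^^ k} in
      \<lparr> lverts = V,
        ledges = {{a, b} | a b. a \<in> V \<and> b \<in> V \<and> (a, b) \<in> adj G},
        lcenter = v,
        lin = (\<lambda>a e. gin G a (port_of G a e)),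
        lout = (\<lambda>a e. fout a (port_of G a e)) \<rparr>)"

definition valid_solution :: "('i, 'o) lcl \<Rightarrow> 'i pgraph \<Rightarrow> (nat \<Rightarrow> nat \<Rightarrow> 'o) \<Rightarrow> bool" where
  "valid_solution L G fout \<longleftrightarrow>
     (\<forall>v<gn G. \<exists>H\<in>lcl_P L. lg_iso (ball G (lcl_r L) v fout) H)"

type_synonym 'i ninfo = "nat \<times> nat \<times> 'i list"

definition ninfo :: "'i pgraph \<Rightarrow> nat \<Rightarrow> 'i ninfo" where
  "ninfo G u = (u, gdeg G u, map (gin G u) [0..<gdeg G u])"

definition backport :: "'i pgraph \<Rightarrow> nat \<Rightarrow> nat \<Rightarrow> nat" where
  "backport G i p = (THE q. q < gdeg G (gnbr G i p) \<and> gnbr G (gnbr G i p) q = i)"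

type_synonym 'i presp = "(nat \<times> 'i ninfo) option"

definition probe :: "'i pgraph \<Rightarrow> nat \<Rightarrow> nat \<Rightarrow> 'i presp" where
  "probe G i p = (if i < gn G \<and> p < gdeg G i
                  then Some (backport G i p, ninfo G (gnbr G i p)) else None)"

datatype 'o step = Probe nat nat | Answer 'o

type_synonym ('i, 'o) strategy = "'i presp list \<Rightarrow> 'o step"

primrec run :: "('i, 'o) strategy \<Rightarrow> 'i pgraph \<Rightarrow> nat \<Rightarrow> 'i presp list \<Rightarrow> 'o option" where
  "run S G 0 h = (case S h of Answer x \<Rightarrow> Some x | Probe i p \<Rightarrow> None)"
| "run S G (Suc k) h = (case S h of Answer x \<Rightarrow> Some x
                                  | Probe i p \<Rightarrow> run S G k (h @ [probe G i p]))"

text \<open>Deterministic LCA: given n, the local information of the queried node v and the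
  queried port p (the query is the half-edge (v,p)), a probing strategy.\<close>
type_synonym ('i, 'o) dlca = "nat \<Rightarrow> 'i ninfo \<Rightarrow> nat \<Rightarrow> ('i, 'o) strategy"

type_synonym ('i, 'o) rlca = "nat \<Rightarrow> (nat \<Rightarrow> bool) \<Rightarrow> 'i ninfo \<Rightarrow> nat \<Rightarrow> ('i, 'o) strategy"

definition coins :: "(nat \<Rightarrow> bool) measure" where
  "coins = PiM UNIV (\<lambda>_. measure_pmf (bernoulli_pmf (1/2)))"

definition det_solves :: "('i, 'o) lcl \<Rightarrow> ('i, 'o) dlca \<Rightarrow> (nat \<Rightarrow> nat) \<Rightarrow> bool" where
  "det_solves L A T \<longleftrightarrow>
     (\<forall>G. wf_pgraph (lcl_delta L) G \<longrightarrow>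
        (\<forall>v<gn G. \<forall>p<gdeg G v. run (A (gn G) (ninfo G v) p) G (T (gn G)) [] \<noteq> None)
      \<and> valid_solution L G (\<lambda>v p. the (run (A (gn G) (ninfo G v) p) G (T (gn G)) [])))"

definition rand_solves :: "('i, 'o) lcl \<Rightarrow> ('i, 'o) rlca \<Rightarrow> (nat \<Rightarrow> nat) \<Rightarrow> real \<Rightarrow> bool" where
  "rand_solves L A T c \<longleftrightarrow>
     (\<forall>G. wf_pgraph (lcl_delta L) G \<longrightarrow>
        (\<forall>\<omega> v p. v < gn G \<longrightarrow> p < gdeg G v \<longrightarrow>
            run (A (gn G) \<omega> (ninfo G v) p) G (T (gn G)) [] \<noteq> None)
      \<and> measure coins {\<omega> \<in> space coins.
            valid_solution L G (\<lambda>v p. the (run (A (gn G) \<omega> (ninfo G v) p) G (T (gn G)) []))}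
          \<ge> 1 - 1 / (real (gn G) powr c))"

definition log_star :: "nat \<Rightarrow> nat" where
  "log_star n = (LEAST k. ((\<lambda>x. log 2 x) ^^ k) (real n) \<le> 1)"

end

theory Submission
  imports Defs
begin

text \<open>Pick a constant \<open>N\<close> with \<open>T N = t\<close> so small that \<open>2 ^ (K * (t + 1)\<^sup>2) < N\<close>, which is where
  \<open>o(\<surd>(log n))\<close> enters, and run the randomized algorithm for \<open>N\<close>-node graphs on graphs of every size. The
  identifiers it sees are colours of a distance-\<open>O(t)\<close> colouring with \<open>M = 2 ^ O(t)\<close> colours, sent to \<open>{..<N}\<close> by an
  injection \<open>\<pi>\<close>; probes of identifiers not seen before are answered as if the node were isolated. Whether a node is
  correct depends on \<open>O(t)\<close> nodes with pairwise different colours, so an error shows up on one of the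
  \<open>2 ^ O(t\<^sup>2)\<close> graphs on \<open>M\<close> nodes of which only \<open>O(t)\<close> are not isolated. By a union bound over these graphs there are coins and
  an injection \<open>\<pi>\<close> for which the algorithm is correct on all of them and never hits an unseen node by guessing its
  identifier.

  The colouring costs \<open>O(log\<^sup>* n)\<close> probes rather than a number exponential in \<open>log\<^sup>* n\<close>: every word of ports of the
  relevant length is a function on the nodes, Cole--Vishkin reduction along such a function explores only a path, the product of
  these constantly many colourings separates nearby nodes, and a greedy pass of constant depth
  brings the number of colours down to \<open>M\<close>.\<close>


section \<open>Adaptive probing programs\<close>

text \<open>Decision trees instead of functions of the history: they allow structural induction and
  sequential composition, and \<open>strat\<close> turns a finished tree into a strategy.\<close>

datatype ('i, 'x) prog = Ret 'x | Ask nat nat "'i presp \<Rightarrow> ('i, 'x) prog"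

primrec exec :: "('i, 'x) prog \<Rightarrow> 'i pgraph \<Rightarrow> 'x" where
  "exec (Ret x) G = x"
| "exec (Ask i p f) G = exec (f (probe G i p)) G"

primrec cost :: "('i, 'x) prog \<Rightarrow> 'i pgraph \<Rightarrow> nat" where
  "cost (Ret x) G = 0"
| "cost (Ask i p f) G = Suc (cost (f (probe G i p)) G)"

primrec bind :: "('i, 'x) prog \<Rightarrow> ('x \<Rightarrow> ('i, 'y) prog) \<Rightarrow> ('i, 'y) prog" where
  "bind (Ret x) k = k x"
| "bind (Ask i p f) k = Ask i p (\<lambda>a. bind (f a) k)"

primrec strat :: "('i, 'o) prog \<Rightarrow> ('i, 'o) strategy" where
  "strat (Ret x) h = Answer x"
| "strat (Ask i p f) h = (case h of [] \<Rightarrow> Probe i p | a # h' \<Rightarrow> strat (f a) h')"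

lemma exec_bind: "exec (bind P k) G = exec (k (exec P G)) G"
  by (induction P) auto

lemma cost_bind: "cost (bind P k) G = cost P G + cost (k (exec P G)) G"
  by (induction P) auto

lemma run_Cons: "run S G k (a # h) = run (\<lambda>h. S (a # h)) G k h"
  by (induction k arbitrary: h) (auto split: step.splits)

lemma run_strat: "cost P G \<le> k \<Longrightarrow> run (strat P) G k [] = Some (exec P G)"
proof (induction P arbitrary: k)
  case (Ret x)
  then show ?case by (cases k) auto
next
  case (Ask i p f)
  then obtain k' where k: "k = Suc k'" and c: "cost (f (probe G i p)) G \<le> k'"
    by (cases k) auto
  have "run (strat (f (probe G i p))) G k' [] = Some (exec (f (probe G i p)) G)"
    using c by (intro Ask.IH) auto
  then show ?case
    by (simp add: k run_Cons)
qed

text \<open>One tree must serve all graphs, well-formed or not. What a query knows without probing,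
  such as the number of nodes, therefore enters as a parameter of \<open>F\<close>.\<close>

definition computable :: "nat \<Rightarrow> ('i pgraph \<Rightarrow> 'x) \<Rightarrow> bool" where
  "computable k F \<longleftrightarrow> (\<exists>P. \<forall>G. exec P G = F G \<and> cost P G \<le> k)"

lemma computable_const: "computable k (\<lambda>G. x)"
  unfolding computable_def by (rule exI[of _ "Ret x"]) auto

lemma computable_mono: "computable k F \<Longrightarrow> k \<le> k' \<Longrightarrow> computable k' F"
  unfolding computable_def by (meson le_trans)

lemma computable_probe: "computable 1 (\<lambda>G. probe G i p)"
  unfolding computable_def by (rule exI[of _ "Ask i p Ret"]) auto

text \<open>The bound \<open>k'\<close> has to hold for every value \<open>x\<close>, including
  values that \<open>F\<close> never takes.\<close>

lemma computable_bind:
  assumes "computable k F" and "\<And>x. computable k' (H x)"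
  shows "computable (k + k') (\<lambda>G. H (F G) G)"
proof -
  obtain P where P: "\<And>G. exec P G = F G" "\<And>G. cost P G \<le> k"
    using assms(1) unfolding computable_def by blast
  obtain Q where Q: "\<And>x G. exec (Q x) G = H x G" "\<And>x G. cost (Q x) G \<le> k'"
    using assms(2) unfolding computable_def by metis
  show ?thesis
    unfolding computable_def
    by (rule exI[of _ "bind P Q"]) (auto simp: exec_bind cost_bind P Q intro: add_mono)
qed

lemma computable_comp: "computable k F \<Longrightarrow> computable k (\<lambda>G. g (F G))"
  using computable_bind[of k F 0 "\<lambda>x G. g x"] by (simp add: computable_const)

lemma computable_map:
  assumes "\<And>x. x \<in> set xs \<Longrightarrow> computable k (F x)"
  shows "computable (length xs * k) (\<lambda>G. map (\<lambda>x. F x G) xs)"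
  using assms
proof (induction xs)
  case Nil
  then show ?case by (simp add: computable_const)
next
  case (Cons x xs)
  have "computable (length xs * k) (\<lambda>G. map (\<lambda>x. F x G) xs)"
    using Cons by simp
  then have "computable (length xs * k) (\<lambda>G. y # map (\<lambda>x. F x G) xs)" for y
    by (rule computable_comp)
  then have "computable (k + length xs * k) (\<lambda>G. F x G # map (\<lambda>x. F x G) xs)"
    by (intro computable_bind[where F = "F x" and H = "\<lambda>y G. y # map (\<lambda>x. F x G) xs"] Cons.prems) auto
  then show ?case by simp
qed

section \<open>Walking along port words\<close>

text \<open>A missing port means staying in place, so every port word acts as a total function on
  nodes.\<close>

definition hop :: "'i pgraph \<Rightarrow> nat \<Rightarrow> nat \<Rightarrow> nat" where
  "hop G p v = (if v < gn G \<and> p < gdeg G v then gnbr G v p else v)"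

definition walk :: "'i pgraph \<Rightarrow> nat list \<Rightarrow> nat \<Rightarrow> nat" where
  "walk G w v = fold (hop G) w v"

text \<open>The letter \<open>d\<close> is never a port when degrees are at most \<open>d\<close>,
  so it always means staying in place; words of length exactly \<open>R\<close> thus reach every
  node at distance at most \<open>R\<close>.\<close>

definition words :: "nat \<Rightarrow> nat \<Rightarrow> nat list list" where
  "words d R = List.n_lists R [0..<Suc d]"

definition near :: "'i pgraph \<Rightarrow> (nat \<times> nat) set" where
  "near G = Id \<union> adj G"

lemma computable_hop: "computable 1 (\<lambda>G. hop G p v)"
proof -
  have "hop G p v = (case probe G v p of None \<Rightarrow> v | Some x \<Rightarrow> fst (snd x))" for G :: "'a pgraph"
    by (auto simp: hop_def probe_def ninfo_def)
  then show ?thesis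
    using computable_comp[OF computable_probe, of "\<lambda>r. case r of None \<Rightarrow> v | Some x \<Rightarrow> fst (snd x)" v p]
    by simp
qed

lemma computable_walk: "computable (length w) (\<lambda>G :: 'i pgraph. walk G w v)"
proof (induction w arbitrary: v)
  case Nil
  then show ?case by (simp add: walk_def computable_const)
next
  case (Cons p w)
  have "computable (1 + length w) (\<lambda>G :: 'i pgraph. walk G w (hop G p v))"
    by (rule computable_bind[where H = "\<lambda>u G. walk G w u"]) (rule computable_hop Cons)+
  then show ?case by (simp add: walk_def)
qed

lemma adj_lt: "wf_pgraph d G \<Longrightarrow> (u, v) \<in> adj G \<Longrightarrow> u < gn G \<and> v < gn G"
  by (auto simp: adj_def wf_pgraph_def)

lemma sym_adj: "wf_pgraph d G \<Longrightarrow> sym (adj G)"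
  by (rule symI) (auto simp: adj_def wf_pgraph_def)

lemma near_lt: "wf_pgraph d G \<Longrightarrow> (u, v) \<in> near G \<Longrightarrow> u < gn G \<Longrightarrow> v < gn G"
  using adj_lt[of d G u v] by (auto simp: near_def)

lemma near_pow_lt: "wf_pgraph d G \<Longrightarrow> (u, v) \<in> near G ^^ k \<Longrightarrow> u < gn G \<Longrightarrow> v < gn G"
  by (induction k arbitrary: v) (auto dest: near_lt)

lemma sym_near_pow: "wf_pgraph d G \<Longrightarrow> (u, v) \<in> near G ^^ k \<Longrightarrow> (v, u) \<in> near G ^^ k"
proof (induction k arbitrary: v)
  case 0
  then show ?case by simp
next
  case (Suc k)
  then obtain w where w: "(u, w) \<in> near G ^^ k" "(w, v) \<in> near G" by auto
  then have "(v, w) \<in> near G"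
    using sym_adj[OF Suc.prems(1)] by (auto simp: near_def dest: symD)
  then show ?case using Suc w by (metis relpow_Suc_I2)
qed

lemma near_pow_mono: "(u, v) \<in> near G ^^ k \<Longrightarrow> k \<le> l \<Longrightarrow> (u, v) \<in> near G ^^ l"
proof (induction l)
  case (Suc l)
  have refl: "(v, v) \<in> near G" by (simp add: near_def)
  show ?case
  proof (cases "k = Suc l")
    case False
    then have "(u, v) \<in> near G ^^ l" using Suc by simp
    then show ?thesis using refl by (rule relpow_Suc_I)
  qed (use Suc.prems in simp)
qed simp

lemma near_pow_iff: "(u, v) \<in> near G ^^ k \<longleftrightarrow> (\<exists>j\<le>k. (u, v) \<in> adj G ^^ j)"
proof
  show "(u, v) \<in> near G ^^ k \<Longrightarrow> \<exists>j\<le>k. (u, v) \<in> adj G ^^ j"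
  proof (induction k arbitrary: v)
    case (Suc k)
    then obtain w where w: "(u, w) \<in> near G ^^ k" "(w, v) \<in> near G" by auto
    then obtain j where "j \<le> k" "(u, w) \<in> adj G ^^ j" using Suc by blast
    moreover have "j \<le> Suc k" "Suc j \<le> Suc k" using \<open>j \<le> k\<close> by auto
    moreover have "v = w \<or> (u, v) \<in> adj G ^^ Suc j"
      using w(2) \<open>(u, w) \<in> adj G ^^ j\<close> by (auto simp: near_def)
    ultimately show ?case by blast
  qed auto
next
  have "(u, v) \<in> adj G ^^ j \<Longrightarrow> (u, v) \<in> near G ^^ j" for j
    unfolding near_def by (induction j arbitrary: v) (simp, blast elim: relpow_Suc_E intro: relpow_Suc_I)
  then show "\<exists>j\<le>k. (u, v) \<in> adj G ^^ j \<Longrightarrow> (u, v) \<in> near G ^^ k"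
    using near_pow_mono by blast
qed

lemma near_iff_hop:
  assumes "wf_pgraph d G" "v < gn G"
  shows "(v, u) \<in> near G \<longleftrightarrow> (\<exists>p\<le>d. hop G p v = u)"
proof
  assume "(v, u) \<in> near G"
  then consider "u = v" | p where "p < gdeg G v" "gnbr G v p = u"
    by (auto simp: near_def adj_def)
  then show "\<exists>p\<le>d. hop G p v = u"
  proof cases
    case 1
    moreover have "gdeg G v \<le> d" using assms by (auto simp: wf_pgraph_def)
    ultimately show ?thesis by (intro exI[of _ d]) (auto simp: hop_def)
  next
    case 2
    moreover have "gdeg G v \<le> d" using assms by (auto simp: wf_pgraph_def)
    ultimately show ?thesis using assms(2) by (intro exI[of _ p]) (auto simp: hop_def)
  qed
next
  assume "\<exists>p\<le>d. hop G p v = u"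
  then show "(v, u) \<in> near G"
    using assms(2) by (auto simp: hop_def near_def adj_def split: if_splits)
qed

lemma set_words: "set (words d R) = {w. length w = R \<and> set w \<subseteq> {..d}}"
  unfolding words_def set_n_lists
  by (auto simp: less_Suc_eq_le subset_iff simp del: upt_Suc)

lemma length_words: "length (words d R) = Suc d ^ R"
  by (simp add: words_def length_n_lists del: upt_Suc)

text \<open>This splits the distance-\<open>R\<close> relation into constantly many functional
  graphs, one for each word, along which colours can be reduced by exploring a path.\<close>

lemma near_pow_iff_walk:
  assumes "wf_pgraph d G" "v < gn G"
  shows "(v, u) \<in> near G ^^ R \<longleftrightarrow> (\<exists>w\<in>set (words d R). walk G w v = u)"
  using assms(2)
proof (induction R arbitrary: v)
  case 0
  then show ?case by (auto simp: set_words walk_def)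
next
  case (Suc R)
  have "(v, u) \<in> near G ^^ Suc R \<longleftrightarrow> (\<exists>x. (v, x) \<in> near G \<and> (x, u) \<in> near G ^^ R)"
    by (metis relpow_Suc_D2 relpow_Suc_I2)
  also have "\<dots> \<longleftrightarrow> (\<exists>x. (v, x) \<in> near G \<and> (\<exists>w\<in>set (words d R). walk G w x = u))"
    using Suc near_lt[OF assms(1)] by metis
  also have "\<dots> \<longleftrightarrow> (\<exists>p\<le>d. \<exists>w\<in>set (words d R). walk G w (hop G p v) = u)"
    using near_iff_hop[OF assms(1) Suc.prems] by metis
  also have "\<dots> \<longleftrightarrow> (\<exists>w\<in>set (words d (Suc R)). walk G w v = u)"
  proof
    assume "\<exists>p\<le>d. \<exists>w\<in>set (words d R). walk G w (hop G p v) = u"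
    then obtain p w where "p \<le> d" "w \<in> set (words d R)" "walk G w (hop G p v) = u" by blast
    then show "\<exists>w\<in>set (words d (Suc R)). walk G w v = u"
      by (intro bexI[of _ "p # w"]) (auto simp: set_words walk_def)
  next
    assume "\<exists>w\<in>set (words d (Suc R)). walk G w v = u"
    then show "\<exists>p\<le>d. \<exists>w\<in>set (words d R). walk G w (hop G p v) = u"
      by (force simp: set_words walk_def length_Suc_conv)
  qed
  finally show ?case .
qed

lemma card_near_pow:
  assumes "wf_pgraph d G" "v < gn G"
  shows "finite {u. (v, u) \<in> near G ^^ R}" "card {u. (v, u) \<in> near G ^^ R} \<le> Suc d ^ R"
proof -
  have eq: "{u. (v, u) \<in> near G ^^ R} = set (map (\<lambda>w. walk G w v) (words d R))"
    using near_pow_iff_walk[OF assms] by auto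
  show "finite {u. (v, u) \<in> near G ^^ R}" unfolding eq by simp
  show "card {u. (v, u) \<in> near G ^^ R} \<le> Suc d ^ R"
    unfolding eq using card_length[of "map (\<lambda>w. walk G w v) (words d R)"]
    by (simp add: length_words)
qed

section \<open>Cole--Vishkin colour reduction\<close>

text \<open>If \<open>x = y\<close>, then the node has no successor in the functional graph and bit 0 is used; this keeps
  the value below \<open>2 * m\<close>, and an equality with the colour of a predecessor still yields a contradiction.\<close>
definition cv_step :: "nat \<Rightarrow> nat \<Rightarrow> nat" where
  "cv_step x y = (let i = (if x = y then 0 else LEAST i. bit x i \<noteq> bit y i)
                  in 2 * i + of_bool (bit x i))"

text \<open>\<open>g j\<close> is the initial colour of the node \<open>j\<close> steps ahead, so
  shifting \<open>g\<close> moves to the successor; \<open>s\<close> rounds read only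
  \<open>g 0\<close>, ..., \<open>g s\<close>.\<close>

primrec cv :: "nat \<Rightarrow> (nat \<Rightarrow> nat) \<Rightarrow> nat" where
  "cv 0 g = g 0"
| "cv (Suc s) g = cv_step (cv s g) (cv s (\<lambda>j. g (Suc j)))"

text \<open>Equal values encode the same bit index and the same bit, but the index was chosen where
  \<open>x\<close> and \<open>y\<close> differ. Nothing is asked of \<open>z\<close>, so
  \<open>y\<close> may belong to a node without successor.\<close>

lemma cv_step_neq: "x \<noteq> y \<Longrightarrow> cv_step x y \<noteq> cv_step y z"
proof
  assume "x \<noteq> y" and eq: "cv_step x y = cv_step y z"
  define i where "i = (LEAST i. bit x i \<noteq> bit y i)"
  define j where "j = (if y = z then 0 else LEAST i. bit y i \<noteq> bit z i)"
  have "\<exists>i. bit x i \<noteq> bit y i"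
    using \<open>x \<noteq> y\<close> bit_eq_iff by blast
  then have neq: "bit x i \<noteq> bit y i"
    unfolding i_def by (rule LeastI_ex)
  have "2 * i + of_bool (bit x i) = 2 * j + (of_bool (bit y j) :: nat)"
    using eq \<open>x \<noteq> y\<close> unfolding cv_step_def Let_def i_def[symmetric] j_def[symmetric]
    by (simp only: if_False)
  then have "i = j \<and> bit x i = bit y j"
    by (cases "bit x i"; cases "bit y j"; simp; presburger)
  then show False using neq by metis
qed

lemma bit_nat_less: "(x::nat) < 2 ^ m \<Longrightarrow> bit x i \<Longrightarrow> i < m"
  by (metis bit_take_bit_iff take_bit_nat_eq_self_iff)

lemma cv_step_less:
  assumes "x < 2 ^ m" "y < 2 ^ m" "m \<ge> 1"
  shows "cv_step x y < 2 * m"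
proof -
  have "(LEAST i. bit x i \<noteq> bit y i) < m" if "x \<noteq> y"
  proof -
    have "\<exists>i. bit x i \<noteq> bit y i" using that bit_eq_iff by blast
    from LeastI_ex[OF this] show ?thesis
      using bit_nat_less[OF assms(1)] bit_nat_less[OF assms(2)] by blast
  qed
  moreover define i where "i = (if x = y then 0 else LEAST i. bit x i \<noteq> bit y i)"
  ultimately have "i < m"
    using assms(3) by (cases "x = y") simp_all
  then show ?thesis
    unfolding cv_step_def Let_def i_def[symmetric] by (cases "bit x i") simp_all
qed

lemma cv_cong: "(\<And>j. j \<le> s \<Longrightarrow> g j = h j) \<Longrightarrow> cv s g = cv s h"
proof (induction s arbitrary: g h)
  case (Suc s)
  have "cv s g = cv s h" "cv s (\<lambda>j. g (Suc j)) = cv s (\<lambda>j. h (Suc j))"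
    by (rule Suc.IH, rule Suc.prems, simp)+
  then show ?case by simp
qed simp

lemma cv_orbit_neq: "f v \<noteq> v \<Longrightarrow> cv s (\<lambda>j. (f ^^ j) v) \<noteq> cv s (\<lambda>j. (f ^^ j) (f v))"
proof (induction s)
  case (Suc s)
  have "(\<lambda>j. (f ^^ Suc j) v) = (\<lambda>j. (f ^^ j) (f v))"
    by (simp add: funpow_Suc_right del: funpow.simps)
  then show ?case
    unfolding cv.simps by (simp only:) (rule cv_step_neq[OF Suc.IH[OF Suc.prems]])
qed simp

text \<open>A bound \<open>16 * x\<close> on the colours gives \<open>m\<close> at most
  \<open>5 + log 2 x\<close> bits, hence new colours below \<open>10 + 2 * log 2 x\<close>, which is
  at most 16 times the maximum of 1 and \<open>log 2 x\<close>. The factor 16 thus survives every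
  round.\<close>

lemma cv_less:
  assumes "\<And>j. g j < n" and "\<And>j. j < s \<Longrightarrow> ((\<lambda>x. log 2 x) ^^ j) (real n) > 1"
  shows "real (cv s g) < 16 * max 1 (((\<lambda>x. log 2 x) ^^ s) (real n))"
  using assms
proof (induction s arbitrary: g)
  case 0
  then have "real (g 0) < real n" by simp
  then show ?case by (simp add: max_def)
next
  case (Suc s)
  define x where "x = ((\<lambda>x. log 2 x) ^^ s) (real n)"
  have x: "x > 1" unfolding x_def by (rule Suc.prems(2)) simp
  define m where "m = nat \<lceil>log 2 (16 * x)\<rceil>"
  have log16: "log 2 (16 * x) = 4 + log 2 x"
    using x log_pow_cancel[of "2::real" 4] by (simp add: log_mult)
  have "log 2 x > 0" using x by simp
  have m_le: "real m \<le> 5 + log 2 x" and m_ge: "log 2 (16 * x) \<le> real m"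
    unfolding m_def using log16 \<open>log 2 x > 0\<close> by linarith+
  have "m \<ge> 1" using m_ge log16 \<open>log 2 x > 0\<close> by linarith
  have "16 * x = 2 powr (log 2 (16 * x))" using x by simp
  also have "\<dots> \<le> 2 powr (real m)" using m_ge by (intro powr_mono) auto
  also have "\<dots> = 2 ^ m" by (simp add: powr_realpow)
  finally have pow: "16 * x \<le> 2 ^ m" .
  have lt: "c < 2 ^ m" if "real c < 16 * max 1 x" for c :: nat
  proof -
    have "real c < 16 * x" using that x by simp
    also note pow
    finally show ?thesis by simp
  qed
  have "cv s h < 2 ^ m" if "\<And>j. h j < n" for h
    unfolding x_def[symmetric] by (rule lt, unfold x_def, rule Suc.IH) (use that Suc.prems in auto)
  then have "cv s g < 2 ^ m" "cv s (\<lambda>j. g (Suc j)) < 2 ^ m"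
    using Suc.prems by auto
  then have "cv (Suc s) g < 2 * m"
    using cv_step_less \<open>m \<ge> 1\<close> by simp
  then have "real (cv (Suc s) g) < 2 * real m" by linarith
  also have "\<dots> \<le> 10 + 2 * log 2 x" using m_le by simp
  also have "\<dots> \<le> 16 * max 1 (log 2 x)" by (simp add: max_def)
  finally show ?case by (simp add: x_def)
qed

lemma log2_le_minus_one: "x \<ge> 2 \<Longrightarrow> log 2 x \<le> x - 1"
proof -
  assume "x \<ge> (2::real)"
  have "ln (x / 2) \<le> x / 2 - 1" using \<open>x \<ge> 2\<close> by (intro ln_le_minus_one) auto
  also have "\<dots> \<le> (x - 2) * ln 2"
    using ln2_ge_two_thirds \<open>x \<ge> 2\<close> mult_left_mono[of "1/2" "ln 2" "x - 2"] by simp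
  finally have "ln x - ln 2 \<le> (x - 2) * ln 2" using \<open>x \<ge> 2\<close> by (simp add: ln_div)
  then have "ln x \<le> (x - 1) * ln 2" by (simp add: algebra_simps)
  then show ?thesis by (simp add: log_def field_simps)
qed

text \<open>If all iterates exceeded 1, they would all be at least 2, since otherwise the next
  logarithm would be below 1; but from 2 on each logarithm lowers the value by at least 1.\<close>

lemma log_star_exists: "\<exists>k. ((\<lambda>x. log 2 x) ^^ k) (real n) \<le> 1"
proof (rule ccontr)
  let ?x = "\<lambda>k. ((\<lambda>x. log 2 x) ^^ k) (real n)"
  assume "\<nexists>k. ?x k \<le> 1"
  then have gt: "?x k > 1" for k by (meson not_le)
  have "?x k \<ge> 2" for k
  proof (rule ccontr)
    assume "\<not> ?x k \<ge> 2"
    then have "log 2 (?x k) < log 2 2" using gt[of k] by (subst log_less_cancel_iff) auto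
    then show False using gt[of "Suc k"] by simp
  qed
  then have "?x (Suc k) \<le> ?x k - 1" for k
    using log2_le_minus_one by simp
  then have "?x k \<le> real n - real k" for k
  proof (induction k)
    case (Suc k)
    then show ?case using Suc.prems[of k] by (simp only: of_nat_Suc) (smt (verit))
  qed simp
  from this[of n] gt[of n] show False by simp
qed

lemma cv_log_star_less: "(\<And>j. g j < n) \<Longrightarrow> cv (log_star n) g < 16"
proof -
  assume g: "\<And>j. g j < n"
  have "((\<lambda>x. log 2 x) ^^ log_star n) (real n) \<le> 1"
    unfolding log_star_def using log_star_exists by (rule LeastI_ex)
  moreover have "((\<lambda>x. log 2 x) ^^ j) (real n) > 1" if "j < log_star n" for j
    using not_less_Least[OF that[unfolded log_star_def]] by simp
  ultimately show ?thesis using cv_less[of g n "log_star n"] g by simp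
qed

text \<open>Lets additive constants be absorbed into the final bound
  \<open>O(log_star n)\<close>.\<close>

lemma log_star_pos: "n \<ge> 2 \<Longrightarrow> log_star n \<ge> 1"
proof (rule ccontr)
  assume "n \<ge> 2" "\<not> log_star n \<ge> 1"
  then have "log_star n = 0" by simp
  then have "((\<lambda>x. log 2 x) ^^ 0) (real n) \<le> 1"
    using LeastI_ex[OF log_star_exists[of n]] unfolding log_star_def by simp
  then show False using \<open>n \<ge> 2\<close> by simp
qed

section \<open>Distance colouring with few probes\<close>

definition mex :: "nat set \<Rightarrow> nat" where
  "mex A = (LEAST x. x \<notin> A)"

lemma mex_notin: "finite A \<Longrightarrow> mex A \<notin> A"
  unfolding mex_def by (rule LeastI_ex) (rule ex_new_if_finite[OF infinite_UNIV_nat])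

lemma mex_le_card: "finite A \<Longrightarrow> mex A \<le> card A"
proof -
  assume "finite A"
  have "{..<mex A} \<subseteq> A" unfolding mex_def using not_less_Least by blast
  from card_mono[OF \<open>finite A\<close> this] show ?thesis by simp
qed

definition cv_word :: "nat \<Rightarrow> 'i pgraph \<Rightarrow> nat list \<Rightarrow> nat \<Rightarrow> nat" where
  "cv_word s G w v = cv s (\<lambda>j. (walk G w ^^ j) v)"

text \<open>A base-16 numeral: after \<open>log_star (gn G)\<close> rounds all the digits are below 16.\<close>
definition base_col :: "nat \<Rightarrow> nat \<Rightarrow> nat \<Rightarrow> 'i pgraph \<Rightarrow> nat \<Rightarrow> nat" where
  "base_col d R s G v = foldr (\<lambda>x a. x + 16 * a) (map (\<lambda>w. cv_word s G w v) (words d R)) 0"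

text \<open>The recursion depth \<open>k\<close> only has to exceed the base colour.\<close>
primrec greedy :: "nat \<Rightarrow> nat \<Rightarrow> nat \<Rightarrow> nat \<Rightarrow> 'i pgraph \<Rightarrow> nat \<Rightarrow> nat" where
  "greedy d R s 0 G v = 0"
| "greedy d R s (Suc k) G v =
     mex (greedy d R s k G ` {u \<in> set (map (\<lambda>w. walk G w v) (words d R)).
                                 base_col d R s G u < base_col d R s G v})"

text \<open>There are \<open>Suc d ^ R\<close> words with one base-16 digit each, so this depth
  exceeds all base colours, and it does not depend on the graph.\<close>

definition dist_col :: "nat \<Rightarrow> nat \<Rightarrow> 'i pgraph \<Rightarrow> nat \<Rightarrow> nat" where
  "dist_col d R G = greedy d R (log_star (gn G)) (16 ^ (Suc d ^ R)) G"

lemma foldr_base16_less: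
  "(\<And>x. x \<in> set xs \<Longrightarrow> x < 16) \<Longrightarrow> foldr (\<lambda>x a. x + 16 * a) xs 0 < (16::nat) ^ length xs"
proof (induction xs)
  case (Cons x xs)
  then have "foldr (\<lambda>x a. x + 16 * a) xs 0 < (16::nat) ^ length xs" "x < 16" by auto
  then show ?case by simp
qed simp

lemma foldr_base16_inj:
  assumes "foldr (\<lambda>x a. x + 16 * a) (map f xs) 0 = foldr (\<lambda>x a. x + 16 * a) (map g xs) (0::nat)"
    and "\<And>x. x \<in> set xs \<Longrightarrow> f x < 16" "\<And>x. x \<in> set xs \<Longrightarrow> g x < 16" and "x \<in> set xs"
  shows "f x = g x"
  using assms
proof (induction xs)
  case (Cons y xs)
  let ?a = "foldr (\<lambda>x a. x + 16 * a) (map f xs) 0"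
  let ?b = "foldr (\<lambda>x a. x + 16 * a) (map g xs) (0::nat)"
  have "f y < 16" "g y < 16" using Cons.prems by auto
  moreover have "f y + 16 * ?a = g y + 16 * ?b" using Cons.prems by simp
  ultimately have "f y = g y \<and> ?a = ?b" by presburger
  then show ?case using Cons by auto
qed simp

text \<open>The orbit is gathered once, step by step. Evaluating the branching recursion of
  \<open>cv\<close> on the stored list then takes no further probes, which keeps the cost linear in
  \<open>s\<close>.\<close>

lemma computable_orbit:
  "computable (s * length w) (\<lambda>G :: 'i pgraph. map (\<lambda>j. (walk G w ^^ j) v) [0..<Suc s])"
proof (induction s)
  case 0
  then show ?case by (simp add: computable_const)
next
  case (Suc s)
  have eq: "map (\<lambda>j. (walk G w ^^ j) v) [0..<Suc (Suc s)] =
      map (\<lambda>j. (walk G w ^^ j) v) [0..<Suc s] @ [walk G w (last (map (\<lambda>j. (walk G w ^^ j) v) [0..<Suc s]))]"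
    for G :: "'i pgraph" by simp
  have "computable (length w) (\<lambda>G :: 'i pgraph. xs @ [walk G w (last xs)])" for xs
    using computable_comp[OF computable_walk] .
  then have "computable (s * length w + length w) (\<lambda>G :: 'i pgraph.
      map (\<lambda>j. (walk G w ^^ j) v) [0..<Suc s] @ [walk G w (last (map (\<lambda>j. (walk G w ^^ j) v) [0..<Suc s]))])"
    by (rule computable_bind[OF Suc, where H = "\<lambda>xs G. xs @ [walk G w (last xs)]"])
  then show ?case unfolding eq by (simp add: add.commute)
qed

lemma computable_base_col:
  "computable (Suc d ^ R * (s * R)) (\<lambda>G :: 'i pgraph. base_col d R s G v)"
proof -
  have "computable (s * R) (\<lambda>G :: 'i pgraph. cv_word s G w v)" if "w \<in> set (words d R)" for w
  proof -
    have eq: "cv_word s G w v = cv s (\<lambda>j. map (\<lambda>j. (walk G w ^^ j) v) [0..<Suc s] ! j)" for G :: "'i pgraph"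
      unfolding cv_word_def by (rule cv_cong) (simp del: upt_Suc)
    have "length w = R" using that by (simp add: set_words)
    then show ?thesis
      unfolding eq
      using computable_comp[OF computable_orbit[of s w v], where g = "\<lambda>xs. cv s (\<lambda>j. xs ! j)"]
      by (simp only:)
  qed
  then have "computable (length (words d R) * (s * R))
      (\<lambda>G :: 'i pgraph. map (\<lambda>w. cv_word s G w v) (words d R))"
    by (rule computable_map)
  from computable_comp[OF this, of "\<lambda>xs. foldr (\<lambda>x a. x + 16 * a) xs 0"] show ?thesis
    by (simp add: base_col_def length_words)
qed

text \<open>\<open>C\<close> may depend on \<open>d\<close>, \<open>R\<close> and the depth
  \<open>k\<close>, but not on the number of rounds \<open>s\<close>.\<close>

lemma computable_greedy:
  "\<exists>C. \<forall>s v. computable (C * Suc s) (\<lambda>G :: 'i pgraph. greedy d R s k G v)"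
proof (induction k)
  case 0
  then show ?case by (auto simp: computable_const)
next
  case (Suc k)
  then obtain C where C: "\<And>s v. computable (C * Suc s) (\<lambda>G :: 'i pgraph. greedy d R s k G v)"
    by blast
  let ?W = "Suc d ^ R"
  define C' where "C' = ?W * R + (?W * (?W * R + C) + ?W * R)"
  have "computable (C' * Suc s) (\<lambda>G :: 'i pgraph. greedy d R s (Suc k) G v)" for s v
  proof -
    let ?b = "\<lambda>(G :: 'i pgraph) v. base_col d R s G v"
    let ?sel = "\<lambda>(ys :: (nat \<times> nat) list) b. mex (snd ` {y \<in> set ys. fst y < b})"
    have b: "computable (?W * R * s) (\<lambda>G. ?b G u)" for u
      using computable_base_col[of d R s u] by (simp add: mult_ac)
    have 1: "computable (length us * (?W * R * s + C * Suc s))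
        (\<lambda>G. map (\<lambda>u. (?b G u, greedy d R s k G u)) us)" for us
    proof (rule computable_map)
      fix u
      show "computable (?W * R * s + C * Suc s) (\<lambda>G. (?b G u, greedy d R s k G u))"
        by (rule computable_bind[OF b, where H = "\<lambda>x G. (x, greedy d R s k G u)"])
           (rule computable_comp[OF C])
    qed
    have 2: "computable (length us * (?W * R * s + C * Suc s) + ?W * R * s)
        (\<lambda>G. ?sel (map (\<lambda>u. (?b G u, greedy d R s k G u)) us) (?b G v))" for us
      by (rule computable_bind[OF 1, where H = "\<lambda>ys G. ?sel ys (?b G v)"])
         (rule computable_comp[OF b])
    have 3: "computable (?W * R) (\<lambda>G :: 'i pgraph. map (\<lambda>w. walk G w v) (words d R))"
    proof -
      have "computable (length (words d R) * R) (\<lambda>G :: 'i pgraph. map (\<lambda>w. walk G w v) (words d R))"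
      proof (rule computable_map)
        fix w assume "w \<in> set (words d R)"
        then show "computable R (\<lambda>G :: 'i pgraph. walk G w v)"
          using computable_walk[of w v] by (simp add: set_words)
      qed
      then show ?thesis by (simp add: length_words)
    qed
    \<comment> \<open>The bound in \<open>computable_bind\<close> must cover every list
      \<open>us\<close>; truncating to the known length \<open>?W\<close> makes the cost uniform and
      does not change the actual list.\<close>
    have 4: "computable (?W * R + (?W * (?W * R * s + C * Suc s) + ?W * R * s))
       (\<lambda>G. ?sel (map (\<lambda>u. (?b G u, greedy d R s k G u)) (take ?W (map (\<lambda>w. walk G w v) (words d R)))) (?b G v))"
    proof (rule computable_bind[OF 3, where H = "\<lambda>us G. ?sel (map (\<lambda>u. (?b G u, greedy d R s k G u)) (take ?W us)) (?b G v)"])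
      fix us :: "nat list"
      show "computable (?W * (?W * R * s + C * Suc s) + ?W * R * s)
        (\<lambda>G. ?sel (map (\<lambda>u. (?b G u, greedy d R s k G u)) (take ?W us)) (?b G v))"
        by (rule computable_mono[OF 2]) (intro add_mono mult_le_mono, auto)
    qed
    have eq: "?sel (map (\<lambda>u. (?b G u, greedy d R s k G u)) (take ?W (map (\<lambda>w. walk G w v) (words d R)))) (?b G v)
      = greedy d R s (Suc k) G v" for G
    proof -
      have "take ?W (map (\<lambda>w. walk G w v) (words d R)) = map (\<lambda>w. walk G w v) (words d R)"
        by (simp add: length_words)
      then show ?thesis
        by (simp only: greedy.simps) (rule arg_cong[where f = mex], force)
    qed
    have "?W * R + (?W * (?W * R * s + C * Suc s) + ?W * R * s) \<le> C' * Suc s"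
      unfolding C'_def by (simp add: algebra_simps)
    from computable_mono[OF 4 this] show ?thesis unfolding eq .
  qed
  then show ?case by blast
qed

context
  fixes d R :: nat and G :: "'i pgraph"
  assumes wf: "wf_pgraph d G"
begin

lemma walk_less: "w \<in> set (words d R) \<Longrightarrow> v < gn G \<Longrightarrow> walk G w v < gn G"
  using near_pow_iff_walk[OF wf, of v] near_pow_lt[OF wf] by blast

lemma cv_word_less:
  assumes "w \<in> set (words d R)" "v < gn G"
  shows "cv_word (log_star (gn G)) G w v < 16"
  unfolding cv_word_def
proof (rule cv_log_star_less)
  show "(walk G w ^^ j) v < gn G" for j
    by (induction j) (use assms walk_less in auto)
qed

lemma base_col_less: "v < gn G \<Longrightarrow> base_col d R (log_star (gn G)) G v < 16 ^ (Suc d ^ R)"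
  using foldr_base16_less[of "map (\<lambda>w. cv_word (log_star (gn G)) G w v) (words d R)"] cv_word_less
  by (auto simp: base_col_def length_words)

text \<open>The word leading from \<open>v\<close> to \<open>u\<close> supplies a digit in which the
  two colours differ.\<close>

lemma base_col_neq:
  assumes "v < gn G" "(v, u) \<in> near G ^^ R" "u \<noteq> v"
  shows "base_col d R (log_star (gn G)) G v \<noteq> base_col d R (log_star (gn G)) G u"
proof
  let ?s = "log_star (gn G)"
  assume eq: "base_col d R ?s G v = base_col d R ?s G u"
  have u: "u < gn G" using near_pow_lt[OF wf assms(2,1)] .
  obtain w where w: "w \<in> set (words d R)" "walk G w v = u"
    using near_pow_iff_walk[OF wf assms(1)] assms(2) by blast
  have "cv_word ?s G w v = cv_word ?s G w u"
    using eq unfolding base_col_def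
    by (rule foldr_base16_inj) (use cv_word_less assms(1) u w(1) in auto)
  then show False
    using cv_orbit_neq[of "walk G w" v ?s] w(2) assms(3) by (simp add: cv_word_def)
qed

lemma greedy_stable:
  "base_col d R s G v < k \<Longrightarrow> k \<le> l \<Longrightarrow> greedy d R s l G v = greedy d R s k G v"
proof (induction k arbitrary: v l)
  case (Suc k)
  then obtain l' where l: "l = Suc l'" "k \<le> l'" by (cases l) auto
  have "greedy d R s l' G u = greedy d R s k G u" if "base_col d R s G u < base_col d R s G v" for u
    using Suc that l by (intro Suc.IH) auto
  then show ?case
    unfolding l(1) greedy.simps by (intro arg_cong[where f = mex] image_cong) auto
qed simp

lemma dist_col_neq:
  assumes "v < gn G" "(v, u) \<in> near G ^^ R" "u \<noteq> v"
  shows "dist_col d R G v \<noteq> dist_col d R G u"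
proof -
  let ?s = "log_star (gn G)"
  have main: "dist_col d R G x \<noteq> dist_col d R G y"
    if "x < gn G" "(x, y) \<in> near G ^^ R" and lt: "base_col d R ?s G y < base_col d R ?s G x" for x y
  proof -
    \<comment> \<open>With the depth written as a successor, one unfolding at \<open>x\<close>
      evaluates its neighbours at depth \<open>k\<close>. Since \<open>y\<close> has a smaller base
      colour than \<open>x\<close>, depth \<open>k\<close> is already enough for it.\<close>
    define k where "k = (16::nat) ^ (Suc d ^ R) - 1"
    have k: "16 ^ (Suc d ^ R) = Suc k" by (simp add: k_def)
    have "base_col d R ?s G x < Suc k"
      using base_col_less[OF that(1)] k by simp
    with lt have "base_col d R ?s G y < k" by simp
    then have y: "dist_col d R G y = greedy d R ?s k G y"
      unfolding dist_col_def k by (rule greedy_stable) simp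
    let ?A = "greedy d R ?s k G ` {u \<in> set (map (\<lambda>w. walk G w x) (words d R)).
                                 base_col d R ?s G u < base_col d R ?s G x}"
    have "dist_col d R G x = mex ?A"
      unfolding dist_col_def k by simp
    moreover have "y \<in> set (map (\<lambda>w. walk G w x) (words d R))"
      using near_pow_iff_walk[OF wf that(1)] that(2) by auto
    then have "dist_col d R G y \<in> ?A" using lt y by auto
    moreover have "finite ?A" by simp
    ultimately show ?thesis using mex_notin by metis
  qed
  have u: "u < gn G" "(u, v) \<in> near G ^^ R"
    using near_pow_lt[OF wf assms(2,1)] sym_near_pow[OF wf assms(2)] by auto
  from base_col_neq[OF assms] show ?thesis
    using main[OF assms(1,2)] main[OF u] by (metis linorder_neqE_nat)
qed

lemma dist_col_less:
  assumes "v < gn G"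
  shows "dist_col d R G v < Suc d ^ R"
proof -
  let ?s = "log_star (gn G)"
  define k where "k = (16::nat) ^ (Suc d ^ R) - 1"
  have k: "16 ^ (Suc d ^ R) = Suc k" by (simp add: k_def)
  let ?N = "set (map (\<lambda>w. walk G w v) (words d R))"
  let ?B = "{u \<in> ?N. base_col d R ?s G u < base_col d R ?s G v}"
  \<comment> \<open>\<open>v\<close> lies in its own neighbourhood but not in \<open>?B\<close>;
    this makes the bound strict.\<close>
  have "(v, v) \<in> near G ^^ R"
    using near_pow_mono[of v v 0 G R] by simp
  then have "v \<in> ?N"
    unfolding set_map near_pow_iff_walk[OF wf assms] by (metis imageI)
  then have "?B \<subset> ?N" by blast
  then have "card ?B < card ?N" by (intro psubset_card_mono) auto
  also have "\<dots> \<le> Suc d ^ R"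
    using card_length[of "map (\<lambda>w. walk G w v) (words d R)"] by (simp add: length_words)
  finally have "card ?B < Suc d ^ R" .
  moreover have "dist_col d R G v = mex (greedy d R ?s k G ` ?B)"
    unfolding dist_col_def k by simp
  moreover have "mex (greedy d R ?s k G ` ?B) \<le> card ?B"
    by (rule order_trans[OF mex_le_card card_image_le]) auto
  ultimately show ?thesis by simp
qed

end

section \<open>Simulation under renamed identifiers\<close>

definition rename_resp :: "(nat \<Rightarrow> nat) \<Rightarrow> 'i presp \<Rightarrow> 'i presp" where
  "rename_resp f r = map_option (\<lambda>(q, w, info). (q, f w, info)) r"

definition outcome :: "('i, 'o) strategy \<Rightarrow> 'i presp list \<Rightarrow> 'o option" where
  "outcome S h = (case S h of Answer x \<Rightarrow> Some x | Probe i p \<Rightarrow> None)"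

definition run_step :: "('i, 'o) strategy \<Rightarrow> 'i pgraph \<Rightarrow> 'i presp list \<Rightarrow> 'i presp list" where
  "run_step S G h = (case S h of Answer x \<Rightarrow> h | Probe i p \<Rightarrow> h @ [probe G i p])"

text \<open>One step of \<open>S\<close> on \<open>G\<close> where node \<open>u\<close> pretends to have the identifier \<open>\<iota> u\<close>. The state holds the
  nodes seen so far with their identifiers, and the history; a probe of an identifier that
  has not been seen is answered as if that node were isolated.\<close>
definition sim_step :: "('i, 'o) strategy \<Rightarrow> 'i pgraph \<Rightarrow> (nat \<Rightarrow> nat) \<Rightarrow>
    (nat \<times> nat) list \<times> 'i presp list \<Rightarrow> (nat \<times> nat) list \<times> 'i presp list" where
  "sim_step S G \<iota> = (\<lambda>(xs, h). case S h of Answer x \<Rightarrow> (xs, h) | Probe i p \<Rightarrow>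
     (case find (\<lambda>y. snd y = i) xs of None \<Rightarrow> (xs, h @ [None])
      | Some y \<Rightarrow> (case probe G (fst y) p of None \<Rightarrow> (xs, h @ [None])
                  | Some (q, w, info) \<Rightarrow> ((w, \<iota> w) # xs, h @ [Some (q, \<iota> w, info)]))))"

definition sim :: "('i, 'o) strategy \<Rightarrow> 'i pgraph \<Rightarrow> (nat \<Rightarrow> nat) \<Rightarrow> nat \<Rightarrow> nat \<Rightarrow>
    (nat \<times> nat) list \<times> 'i presp list" where
  "sim S G \<iota> k v = (sim_step S G \<iota> ^^ k) ([(v, \<iota> v)], [])"

definition seen :: "('i, 'o) strategy \<Rightarrow> 'i pgraph \<Rightarrow> (nat \<Rightarrow> nat) \<Rightarrow> nat \<Rightarrow> nat \<Rightarrow> nat set" where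
  "seen S G \<iota> k v = fst ` set (fst (sim S G \<iota> k v))"

lemma sim_0: "sim S G \<iota> 0 v = ([(v, \<iota> v)], [])"
  by (simp add: sim_def)

lemma sim_Suc: "sim S G \<iota> (Suc k) v = sim_step S G \<iota> (sim S G \<iota> k v)"
  by (simp add: sim_def)

lemma run_eq_outcome: "run S G k h = outcome S ((run_step S G ^^ k) h)"
proof (induction k arbitrary: h)
  case 0
  then show ?case by (simp add: outcome_def)
next
  case (Suc k)
  show ?case
  proof (cases "S h")
    case (Probe i p)
    then show ?thesis
      using Suc[of "h @ [probe G i p]"] by (simp add: funpow_Suc_right run_step_def del: funpow.simps)
  next
    case (Answer x)
    then have "run_step S G h = h" by (simp add: run_step_def)
    then have "(run_step S G ^^ j) h = h" for j by (induction j) auto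
    then show ?thesis using Answer by (simp add: outcome_def del: funpow.simps)
  qed
qed

lemma seen_0: "seen S G \<iota> 0 v = {v}"
  by (simp add: seen_def sim_0)

lemma seen_Suc_mono: "seen S G \<iota> k v \<subseteq> seen S G \<iota> (Suc k) v"
  unfolding seen_def sim_Suc
  by (auto simp: sim_step_def split: prod.splits step.splits option.splits)

lemma seen_mono: "j \<le> k \<Longrightarrow> seen S G \<iota> j v \<subseteq> seen S G \<iota> k v"
  by (rule lift_Suc_mono_le[of "\<lambda>k. seen S G \<iota> k v"]) (rule seen_Suc_mono)

lemma start_in_seen: "v \<in> seen S G \<iota> k v"
  using seen_mono[of 0 k S G \<iota> v] by (simp add: seen_0)

lemma card_seen: "finite (seen S G \<iota> k v)" "card (seen S G \<iota> k v) \<le> Suc k"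
proof -
  show "finite (seen S G \<iota> k v)" by (simp add: seen_def)
  have "length (fst (sim S G \<iota> k v)) \<le> Suc k"
  proof (induction k)
    case (Suc k)
    have "length (fst (sim_step S G \<iota> st)) \<le> Suc (length (fst st))" for st
      by (auto simp: sim_step_def split: prod.splits step.splits option.splits)
    from this[of "sim S G \<iota> k v"] Suc show ?case unfolding sim_Suc by linarith
  qed (simp add: sim_0)
  moreover have "card (seen S G \<iota> k v) \<le> length (fst (sim S G \<iota> k v))"
    unfolding seen_def by (metis card_length list.set_map length_map)
  ultimately show "card (seen S G \<iota> k v) \<le> Suc k" by linarith
qed

lemma sim_ids: "y \<in> set (fst (sim S G \<iota> k v)) \<Longrightarrow> snd y = \<iota> (fst y)"
proof (induction k arbitrary: y)
  case (Suc k)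
  then show ?case
    unfolding sim_Suc
    by (fastforce simp: sim_step_def split: prod.splits step.splits option.splits)
qed (simp add: sim_0)

lemma probe_SomeD: "probe G u p = Some (q, w, info) \<Longrightarrow> (u, w) \<in> adj G \<and> w = gnbr G u p \<and> p < gdeg G u"
  by (auto simp: probe_def ninfo_def adj_def split: if_splits)

text \<open>Only nodes already seen are ever probed, so each step goes at most one edge beyond the
  nodes known before.\<close>

lemma seen_near: "u \<in> seen S G \<iota> k v \<Longrightarrow> (v, u) \<in> near G ^^ k"
proof (induction k arbitrary: u)
  case 0
  then show ?case by (simp add: seen_0)
next
  case (Suc k)
  show ?case
  proof (cases "u \<in> seen S G \<iota> k v")
    case True
    then show ?thesis using Suc.IH near_pow_mono by (metis le_SucI order_refl)
  next
    case False
    obtain xs h where st: "sim S G \<iota> k v = (xs, h)" by fastforce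
    have "u \<in> fst ` set (fst (sim_step S G \<iota> (xs, h)))" "u \<notin> fst ` set xs"
      using Suc.prems False by (auto simp: seen_def sim_Suc st)
    then obtain i p y q info where "find (\<lambda>y. snd y = i) xs = Some y" and pr: "probe G (fst y) p = Some (q, u, info)"
      by (force simp: sim_step_def split: step.splits option.splits)
    then have "y \<in> set xs" by (auto simp: find_Some_iff)
    then have "fst y \<in> seen S G \<iota> k v" by (auto simp: seen_def st)
    then have "(v, fst y) \<in> near G ^^ k" by (rule Suc.IH)
    moreover have "(fst y, u) \<in> near G" using probe_SomeD[OF pr] unfolding near_def by blast
    ultimately show ?thesis by (rule relpow_Suc_I)
  qed
qed

text \<open>Each simulated step costs at most one probe of the graph and the identifier of one new
  node; the first summand pays for the identifier of the start node.\<close>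

lemma computable_sim:
  assumes "\<And>w. computable c (\<lambda>G. \<iota> G w)"
  shows "computable (c + k * (1 + c)) (\<lambda>G. sim S G (\<iota> G) k v)"
proof (induction k)
  case 0
  then show ?case
    using computable_comp[OF assms, where g = "\<lambda>i. ([(v, i)], [])"] by (simp add: sim_0)
next
  case (Suc k)
  have step: "computable (1 + c) (\<lambda>G. sim_step S G (\<iota> G) st)" for st
  proof -
    obtain xs h where st: "st = (xs, h)" by fastforce
    show ?thesis
    proof (cases "S h")
      case (Answer x)
      then show ?thesis by (simp add: sim_step_def st computable_const)
    next
      case (Probe i p)
      show ?thesis
      proof (cases "find (\<lambda>y. snd y = i) xs")
        case None
        then show ?thesis using Probe by (simp add: sim_step_def st computable_const)
      next
        case (Some y)
        define H where "H = (\<lambda>r G. case r of None \<Rightarrow> (xs, h @ [None])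
            | Some (q, w, info) \<Rightarrow> ((w, \<iota> G w) # xs, h @ [Some (q, \<iota> G w, info)]))"
        have "computable c (H r)" for r
        proof (cases r)
          case (Some x)
          then show ?thesis
            using computable_comp[OF assms, where g = "\<lambda>j. ((fst (snd x), j) # xs, h @ [Some (fst x, j, snd (snd x))])"]
            by (simp add: H_def case_prod_beta)
        qed (simp add: H_def computable_const)
        from computable_bind[OF computable_probe[of "fst y" p] this]
        have "computable (1 + c) (\<lambda>G. H (probe G (fst y) p) G)" .
        then show ?thesis using Probe Some by (simp add: sim_step_def st H_def)
      qed
    qed
  qed
  have "computable (c + k * (1 + c) + (1 + c)) (\<lambda>G. sim_step S G (\<iota> G) (sim S G (\<iota> G) k v))"
    by (rule computable_bind[where H = "\<lambda>st G. sim_step S G (\<iota> G) st"], rule Suc, rule step)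
  then show ?case by (simp add: sim_Suc add_ac)
qed

lemma find_map: "find P (map f xs) = map_option f (find (P \<circ> f) xs)"
  by (induction xs) auto

text \<open>The simulation is determined by the answers at the nodes it visits. \<open>D\<close>
  contains everything seen, so probes have to correspond only where the node and the neighbour
  reached both lie in \<open>D\<close>.\<close>

lemma sim_transfer:
  assumes probe: "\<And>u p. u \<in> D \<Longrightarrow> (p < gdeg G u \<Longrightarrow> gnbr G u p \<in> D) \<Longrightarrow>
      probe H (f u) p = rename_resp f (probe G u p)"
    and ids: "\<And>u. u \<in> D \<Longrightarrow> \<kappa> (f u) = \<iota> u"
    and lt: "\<And>u. u \<in> D \<Longrightarrow> u < gn G"
    and D: "seen S G \<iota> k v \<subseteq> D"
  shows "sim S H \<kappa> k (f v) = map_prod (map (apfst f)) id (sim S G \<iota> k v)"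
  using D
proof (induction k)
  case 0
  then show ?case using ids by (auto simp: sim_0 seen_0)
next
  case (Suc k)
  obtain xs h where st: "sim S G \<iota> k v = (xs, h)" by fastforce
  have sub: "seen S G \<iota> k v \<subseteq> D" using Suc.prems seen_Suc_mono by blast
  have "sim S H \<kappa> k (f v) = map_prod (map (apfst f)) id (sim S G \<iota> k v)"
    using Suc.IH sub by blast
  then have st': "sim S H \<kappa> k (f v) = (map (apfst f) xs, h)" by (simp add: st)
  show ?case
  proof (cases "S h")
    case (Answer x)
    then show ?thesis by (simp add: sim_Suc st st' sim_step_def)
  next
    case (Probe i p)
    have find: "find (\<lambda>y. snd y = i) (map (apfst f) xs) = map_option (apfst f) (find (\<lambda>y. snd y = i) xs)"
      by (simp add: find_map comp_def)
    show ?thesis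
    proof (cases "find (\<lambda>y. snd y = i) xs")
      case None
      then show ?thesis using Probe find by (simp add: sim_Suc st st' sim_step_def)
    next
      case (Some y)
      then have "y \<in> set xs" by (auto simp: find_Some_iff)
      then have y: "fst y \<in> D" using sub by (auto simp: seen_def st)
      have nb: "gnbr G (fst y) p \<in> D" if deg: "p < gdeg G (fst y)"
      proof -
        obtain q info where "probe G (fst y) p = Some (q, gnbr G (fst y) p, info)"
          using deg lt[OF y] by (simp add: probe_def ninfo_def)
        then have "gnbr G (fst y) p \<in> seen S G \<iota> (Suc k) v"
          using Probe Some by (simp add: seen_def sim_Suc st sim_step_def)
        then show ?thesis using Suc.prems by blast
      qed
      have pr: "probe H (f (fst y)) p = rename_resp f (probe G (fst y) p)"
        by (rule probe[OF y nb])
      show ?thesis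
      proof (cases "probe G (fst y) p")
        case None
        then show ?thesis
          using pr Probe Some find by (simp add: sim_Suc st st' sim_step_def rename_resp_def)
      next
        case (Some z)
        obtain q w info where z: "z = (q, w, info)" by (cases z) auto
        have "w \<in> D"
          using probe_SomeD[OF Some[unfolded z]] nb by blast
        then show ?thesis
          using Some Probe \<open>find (\<lambda>y. snd y = i) xs = Some y\<close> find pr ids[of w]
          by (simp add: sim_Suc st st' sim_step_def z rename_resp_def)
      qed
    qed
  qed
qed


section \<open>Embedding a graph into a larger set of identifiers\<close>

definition push :: "nat \<Rightarrow> (nat \<Rightarrow> nat) \<Rightarrow> 'i pgraph \<Rightarrow> 'i pgraph" where
  "push N \<pi> H = (let \<rho> = inv_into {..<gn H} \<pi> in
     \<lparr>gn = N, gdeg = (\<lambda>x. if x \<in> \<pi> ` {..<gn H} then gdeg H (\<rho> x) else 0),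
      gnbr = (\<lambda>x p. \<pi> (gnbr H (\<rho> x) p)), gin = (\<lambda>x p. gin H (\<rho> x) p)\<rparr>)"

context
  fixes d N :: nat and \<pi> :: "nat \<Rightarrow> nat" and H :: "'i pgraph"
  assumes wf: "wf_pgraph d H" and inj: "inj_on \<pi> {..<gn H}" and img: "\<pi> ` {..<gn H} \<subseteq> {..<N}"
begin

lemma push_simps:
  "gn (push N \<pi> H) = N"
  "a < gn H \<Longrightarrow> gdeg (push N \<pi> H) (\<pi> a) = gdeg H a"
  "x \<notin> \<pi> ` {..<gn H} \<Longrightarrow> gdeg (push N \<pi> H) x = 0"
  "a < gn H \<Longrightarrow> gnbr (push N \<pi> H) (\<pi> a) p = \<pi> (gnbr H a p)"
  "a < gn H \<Longrightarrow> gin (push N \<pi> H) (\<pi> a) p = gin H a p"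
  using inj by (auto simp: push_def Let_def)

lemma push_nbr:
  assumes "a < gn H" "p < gdeg H a"
  shows "gnbr H a p < gn H" "gnbr H a p \<noteq> a" "\<exists>q<gdeg H (gnbr H a p). gnbr H (gnbr H a p) q = a"
  using wf assms unfolding wf_pgraph_def by auto

lemma push_less: "a < gn H \<Longrightarrow> \<pi> a < N"
  using img by auto

lemma push_eq_iff: "a < gn H \<Longrightarrow> b < gn H \<Longrightarrow> \<pi> a = \<pi> b \<longleftrightarrow> a = b"
  using inj by (auto dest: inj_onD)

lemma wf_push: "wf_pgraph d (push N \<pi> H)"
proof -
  have "gdeg (push N \<pi> H) x \<le> d \<and> inj_on (gnbr (push N \<pi> H) x) {..<gdeg (push N \<pi> H) x}
     \<and> (\<forall>p<gdeg (push N \<pi> H) x. gnbr (push N \<pi> H) x p < N \<and> gnbr (push N \<pi> H) x p \<noteq> x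
        \<and> (\<exists>q<gdeg (push N \<pi> H) (gnbr (push N \<pi> H) x p). gnbr (push N \<pi> H) (gnbr (push N \<pi> H) x p) q = x))"
    for x
  proof (cases "x \<in> \<pi> ` {..<gn H}")
    case True
    then obtain a where a: "a < gn H" "x = \<pi> a" by auto
    have "inj_on (gnbr H a) {..<gdeg H a}" "gdeg H a \<le> d"
      using wf a unfolding wf_pgraph_def by auto
    moreover from this have "inj_on (\<lambda>p. \<pi> (gnbr H a p)) {..<gdeg H a}"
      using push_nbr(1)[OF a(1)] by (auto simp: inj_on_def push_eq_iff)
    then have "inj_on (gnbr (push N \<pi> H) (\<pi> a)) {..<gdeg H a}"
      using a(1) by (simp add: push_simps inj_on_def)
    moreover have "\<exists>q<gdeg H (gnbr H a p). \<pi> (gnbr H (gnbr H a p) q) = \<pi> a" if "p < gdeg H a" for p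
      using push_nbr(3)[OF a(1) that] by metis
    ultimately show ?thesis
      using a(1) push_nbr(1,2)[OF a(1)] by (simp add: a(2) push_simps push_eq_iff push_less)
  qed (simp add: push_simps)
  then show ?thesis unfolding wf_pgraph_def push_simps by blast
qed

lemma ninfo_push: "a < gn H \<Longrightarrow> ninfo (push N \<pi> H) (\<pi> a) = (\<pi> a, snd (ninfo H a))"
  by (simp add: ninfo_def push_simps)

lemma probe_push:
  assumes a: "a < gn H"
  shows "probe (push N \<pi> H) (\<pi> a) p = rename_resp \<pi> (probe H a p)"
proof (cases "p < gdeg H a")
  case True
  let ?b = "gnbr H a p"
  have b: "?b < gn H" using push_nbr(1)[OF a True] .
  have "backport (push N \<pi> H) (\<pi> a) p = (THE q. q < gdeg H ?b \<and> \<pi> (gnbr H ?b q) = \<pi> a)"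
    using a b by (simp add: backport_def push_simps)
  also have "\<dots> = backport H a p"
    unfolding backport_def using push_eq_iff[OF push_nbr(1)[OF b] a] by metis
  finally show ?thesis
    using True a b push_less by (simp add: probe_def push_simps rename_resp_def ninfo_push case_prod_beta)
       (simp add: ninfo_def)
qed (simp add: probe_def push_simps a rename_resp_def)

text \<open>Identifiers outside the image belong to isolated nodes, where a real probe fails just as
  the simulation reports.\<close>

lemma probe_push_isolated: "x \<notin> \<pi> ` {..<gn H} \<Longrightarrow> probe (push N \<pi> H) x p = None"
  by (simp add: probe_def push_simps)

end

text \<open>The one way in which simulation and real run can diverge: the strategy names the
  identifier of a node that it has not reached.\<close>

definition far_hit :: "('i, 'o) strategy \<Rightarrow> 'i pgraph \<Rightarrow> (nat \<Rightarrow> nat) \<Rightarrow> nat \<Rightarrow> nat \<Rightarrow> nat \<Rightarrow> bool" where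
  "far_hit S H \<pi> j a b \<longleftrightarrow> b \<notin> seen S H \<pi> j a \<and>
     (\<exists>p. S (snd (sim S H \<pi> j a)) = Probe (\<pi> b) p)"

lemma run_push_eq_sim:
  assumes wf: "wf_pgraph d H" and inj: "inj_on \<pi> {..<gn H}" and img: "\<pi> ` {..<gn H} \<subseteq> {..<N}"
    and a: "a < gn H" and nofar: "\<And>j b. j < k \<Longrightarrow> b < gn H \<Longrightarrow> \<not> far_hit S H \<pi> j a b"
  shows "run S (push N \<pi> H) k [] = outcome S (snd (sim S H \<pi> k a))"
proof -
  have "(run_step S (push N \<pi> H) ^^ k) [] = snd (sim S H \<pi> k a)"
    using nofar
  proof (induction k)
    case 0
    then show ?case by (simp add: sim_0)
  next
    case (Suc k)
    obtain xs h where st: "sim S H \<pi> k a = (xs, h)" by fastforce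
    have "(run_step S (push N \<pi> H) ^^ k) [] = h" using Suc st by simp
    then have IH: "(run_step S (push N \<pi> H) ^^ Suc k) [] = run_step S (push N \<pi> H) h" by simp
    have "run_step S (push N \<pi> H) h = snd (sim S H \<pi> (Suc k) a)"
    proof (cases "S h")
      case (Answer x)
      then show ?thesis by (simp add: sim_Suc st sim_step_def run_step_def)
    next
      case (Probe i p)
      show ?thesis
      proof (cases "find (\<lambda>y. snd y = i) xs")
        case None
        \<comment> \<open>An unseen identifier that belonged to \<open>H\<close> would be a far hit.
          Hence it names an isolated node, and \<open>None\<close> is the true answer.\<close>
        have "i \<notin> \<pi> ` {..<gn H}"
        proof
          assume "i \<in> \<pi> ` {..<gn H}"
          then obtain b where b: "b < gn H" "i = \<pi> b" by auto
          have "b \<in> seen S H \<pi> k a"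
            using Suc.prems[of k b] b Probe st by (auto simp: far_hit_def)
          then obtain y where "y \<in> set xs" "fst y = b" by (auto simp: seen_def st)
          moreover from this have "snd y = \<pi> b" using sim_ids[of y S H \<pi> k a] by (simp add: st)
          ultimately show False using None b(2) unfolding find_None_iff by metis
        qed
        from probe_push_isolated[OF wf inj img this, of p] show ?thesis
          using None Probe by (simp add: sim_Suc st sim_step_def run_step_def)
      next
        case (Some y)
        then have y: "y \<in> set xs" "snd y = i" by (auto simp: find_Some_iff)
        then have "fst y \<in> seen S H \<pi> k a" by (auto simp: seen_def st)
        then have "fst y < gn H" using seen_near near_pow_lt[OF wf] a by metis
        moreover have "i = \<pi> (fst y)" using sim_ids[of y S H \<pi> k a] y by (simp add: st)
        ultimately have "probe (push N \<pi> H) i p = rename_resp \<pi> (probe H (fst y) p)"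
          using probe_push[OF wf inj img] by simp
        then show ?thesis
          using Some Probe
          by (auto simp: sim_Suc st sim_step_def run_step_def rename_resp_def split: option.split)
      qed
    qed
    then show ?case unfolding IH .
  qed
  then show ?thesis by (simp add: run_eq_outcome)
qed

section \<open>Cutting out the explored part of a graph\<close>

definition lookup :: "(nat \<times> 'b list) list \<Rightarrow> nat \<Rightarrow> 'b list" where
  "lookup es a = (case map_of es a of None \<Rightarrow> [] | Some l \<Rightarrow> l)"

text \<open>A sparse graph is coded by the list of its non-isolated nodes with their adjacency lists, so that
  sparse graphs can be counted.\<close>
definition decode :: "nat \<Rightarrow> (nat \<times> (nat \<times> 'i) list) list \<Rightarrow> 'i pgraph" where
  "decode M es = \<lparr>gn = M, gdeg = (\<lambda>a. length (lookup es a)),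
     gnbr = (\<lambda>a p. fst (lookup es a ! p)), gin = (\<lambda>a p. snd (lookup es a ! p))\<rparr>"

definition codes :: "nat \<Rightarrow> nat \<Rightarrow> nat \<Rightarrow> (nat \<times> (nat \<times> 'i) list) list set" where
  "codes d M m = {es. set es \<subseteq> {..<M} \<times> {l. set l \<subseteq> {..<M} \<times> UNIV \<and> length l \<le> d} \<and> length es \<le> m}"

definition sparse_graphs :: "nat \<Rightarrow> nat \<Rightarrow> nat \<Rightarrow> 'i pgraph set" where
  "sparse_graphs d M m = {H \<in> decode M ` codes d M m. wf_pgraph d H}"

text \<open>Nodes of \<open>D\<close> keep all their edges, so the other endpoints have to be
  present as well.\<close>

definition halo :: "'i pgraph \<Rightarrow> nat set \<Rightarrow> nat set" where
  "halo G D = D \<union> adj G `` D"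

definition ports :: "'i pgraph \<Rightarrow> nat set \<Rightarrow> nat \<Rightarrow> nat list" where
  "ports G D u = filter (\<lambda>p. u \<in> D \<or> gnbr G u p \<in> D) [0..<gdeg G u]"

definition code :: "'i pgraph \<Rightarrow> nat set \<Rightarrow> (nat \<Rightarrow> nat) \<Rightarrow> (nat \<times> (nat \<times> 'i) list) list" where
  "code G D f = map (\<lambda>u. (f u, map (\<lambda>p. (f (gnbr G u p), gin G u p)) (ports G D u)))
     (sorted_list_of_set (halo G D))"

text \<open>The nodes of \<open>D\<close> keep their degrees and ports; the other nodes of the halo lose the edges that do not
  lead to \<open>D\<close> and have their ports renumbered.\<close>
definition cutout :: "nat \<Rightarrow> 'i pgraph \<Rightarrow> nat set \<Rightarrow> (nat \<Rightarrow> nat) \<Rightarrow> 'i pgraph" where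
  "cutout M G D f = decode M (code G D f)"

lemma geometric_sum_le: "(\<Sum>i\<le>m. a ^ i) \<le> Suc a ^ m"
proof (induction m)
  case (Suc m)
  have "a * a ^ m \<le> a * Suc a ^ m" by (intro mult_le_mono power_mono) auto
  from add_mono[OF Suc this] show ?case by simp
qed simp

lemma finite_codes: "finite (codes d M m :: (nat \<times> (nat \<times> 'i::finite) list) list set)"
  unfolding codes_def by (intro finite_lists_length_le finite_cartesian_product) auto

text \<open>A code has at most \<open>m\<close> entries, so \<open>m\<close> and not
  \<open>M\<close> stands in the exponent. This makes the union bound affordable, since
  \<open>M\<close> will be exponential in the number of probes.\<close>

lemma card_codes:
  "card (codes d M m :: (nat \<times> (nat \<times> 'i::finite) list) list set) \<le> Suc (M * Suc (M * CARD('i)) ^ d) ^ m"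
proof -
  let ?A = "{..<M} \<times> (UNIV :: 'i set)"
  let ?L = "{l. set l \<subseteq> ?A \<and> length l \<le> d}"
  have "card ?L = (\<Sum>i\<le>d. card ?A ^ i)" by (rule card_lists_length_le) auto
  also have "\<dots> \<le> Suc (M * CARD('i)) ^ d"
    using geometric_sum_le[of "M * CARD('i)" d] by (simp add: card_cartesian_product)
  finally have L: "card ({..<M} \<times> ?L) \<le> M * Suc (M * CARD('i)) ^ d"
    by (simp add: card_cartesian_product)
  have fin: "finite ({..<M} \<times> ?L)" by (intro finite_cartesian_product finite_lists_length_le) auto
  have "card (codes d M m :: (nat \<times> (nat \<times> 'i) list) list set) = (\<Sum>i\<le>m. card ({..<M} \<times> ?L) ^ i)"
    unfolding codes_def by (rule card_lists_length_le[OF fin])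
  also have "\<dots> \<le> Suc (card ({..<M} \<times> ?L)) ^ m" by (rule geometric_sum_le)
  also have "\<dots> \<le> Suc (M * Suc (M * CARD('i)) ^ d) ^ m" using L by (intro power_mono) auto
  finally show ?thesis .
qed

lemma finite_sparse_graphs: "finite (sparse_graphs d M m :: 'i::finite pgraph set)"
  unfolding sparse_graphs_def by (rule finite_subset[OF _ finite_imageI[OF finite_codes]]) auto

lemma card_sparse_graphs:
  "card (sparse_graphs d M m :: 'i::finite pgraph set) \<le> Suc (M * Suc (M * CARD('i)) ^ d) ^ m"
proof -
  have "card (sparse_graphs d M m :: 'i pgraph set) \<le> card (decode M ` (codes d M m :: (nat \<times> (nat \<times> 'i) list) list set))"
    unfolding sparse_graphs_def by (rule card_mono) (use finite_codes in auto)
  also have "\<dots> \<le> card (codes d M m :: (nat \<times> (nat \<times> 'i) list) list set)"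
    by (rule card_image_le[OF finite_codes])
  finally show ?thesis using card_codes le_trans by blast
qed

lemma sparse_graphsD: "H \<in> sparse_graphs d M m \<Longrightarrow> wf_pgraph d H \<and> gn H = M"
  by (auto simp: sparse_graphs_def decode_def)

context
  fixes d M :: nat and G :: "'i pgraph" and D :: "nat set" and f :: "nat \<Rightarrow> nat"
  assumes wf: "wf_pgraph d G" and D: "D \<subseteq> {..<gn G}"
    and inj: "inj_on f (halo G D)" and img: "f ` halo G D \<subseteq> {..<M}"
begin

lemma halo_less: "halo G D \<subseteq> {..<gn G}"
  using D adj_lt[OF wf] by (auto simp: halo_def)

lemma finite_halo: "finite (halo G D)"
  using halo_less finite_subset by blast

lemma card_halo: "card (halo G D) \<le> card D * Suc d"
proof -
  have finD: "finite D" using D finite_subset by blast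
  have "halo G D = (\<Union>u\<in>D. insert u (gnbr G u ` {..<gdeg G u}))"
    using D by (auto simp: halo_def adj_def)
  also have "card \<dots> \<le> (\<Sum>u\<in>D. card (insert u (gnbr G u ` {..<gdeg G u})))"
    by (rule card_UN_le[OF finD])
  also have "\<dots> \<le> (\<Sum>u\<in>D. Suc d)"
  proof (rule sum_mono)
    fix u assume "u \<in> D"
    then have "gdeg G u \<le> d" using wf D by (auto simp: wf_pgraph_def)
    moreover have "card (gnbr G u ` {..<gdeg G u}) \<le> gdeg G u"
      using card_image_le[of "{..<gdeg G u}" "gnbr G u"] by simp
    ultimately show "card (insert u (gnbr G u ` {..<gdeg G u})) \<le> Suc d"
      using card_insert_le_m1[of "Suc d"] by (simp add: card_insert_if)
  qed
  finally show ?thesis by simp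
qed

lemma ports_D: "u \<in> D \<Longrightarrow> ports G D u = [0..<gdeg G u]"
  by (simp add: ports_def)

lemma ports_lt: "p \<in> set (ports G D u) \<Longrightarrow> p < gdeg G u"
  by (simp add: ports_def)

lemma nbr_in_halo: "u < gn G \<Longrightarrow> p \<in> set (ports G D u) \<Longrightarrow> gnbr G u p \<in> halo G D"
  by (auto simp: ports_def halo_def adj_def)

lemma lookup_code:
  assumes "u \<in> halo G D"
  shows "lookup (code G D f) (f u) = map (\<lambda>p. (f (gnbr G u p), gin G u p)) (ports G D u)"
proof -
  have "distinct (map fst (code G D f))"
    using inj finite_halo by (simp add: code_def comp_def distinct_map)
  moreover have "(f u, map (\<lambda>p. (f (gnbr G u p), gin G u p)) (ports G D u)) \<in> set (code G D f)"
    using assms finite_halo by (auto simp: code_def)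
  ultimately show ?thesis by (simp add: lookup_def)
qed

lemma lookup_code_None:
  assumes "a \<notin> f ` halo G D"
  shows "lookup (code G D f) a = []"
proof -
  have "a \<notin> fst ` set (code G D f)"
    using assms finite_halo by (auto simp: code_def)
  then have "map_of (code G D f) a = None" by (simp add: map_of_eq_None_iff)
  then show ?thesis by (simp add: lookup_def)
qed

lemma cutout_simps:
  "gn (cutout M G D f) = M"
  "a \<notin> f ` halo G D \<Longrightarrow> gdeg (cutout M G D f) a = 0"
  "u \<in> halo G D \<Longrightarrow> gdeg (cutout M G D f) (f u) = length (ports G D u)"
  "u \<in> halo G D \<Longrightarrow> p < length (ports G D u) \<Longrightarrow> gnbr (cutout M G D f) (f u) p = f (gnbr G u (ports G D u ! p))"
  "u \<in> halo G D \<Longrightarrow> p < length (ports G D u) \<Longrightarrow> gin (cutout M G D f) (f u) p = gin G u (ports G D u ! p)"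
  by (simp_all add: cutout_def decode_def lookup_code lookup_code_None)

lemma cutout_simps_D:
  assumes "u \<in> D"
  shows "gdeg (cutout M G D f) (f u) = gdeg G u"
    "p < gdeg G u \<Longrightarrow> gnbr (cutout M G D f) (f u) p = f (gnbr G u p)"
    "p < gdeg G u \<Longrightarrow> gin (cutout M G D f) (f u) p = gin G u p"
proof -
  have u: "u \<in> halo G D" using assms by (simp add: halo_def)
  show "gdeg (cutout M G D f) (f u) = gdeg G u"
    unfolding cutout_simps(3)[OF u] ports_D[OF assms] by simp
  assume "p < gdeg G u"
  then show "gnbr (cutout M G D f) (f u) p = f (gnbr G u p)" "gin (cutout M G D f) (f u) p = gin G u p"
    using cutout_simps(4,5)[OF u, of p] unfolding ports_D[OF assms] by simp_all
qed

lemma length_ports: "u < gn G \<Longrightarrow> length (ports G D u) \<le> d"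
proof -
  assume "u < gn G"
  then have "gdeg G u \<le> d" using wf by (auto simp: wf_pgraph_def)
  moreover have "length (ports G D u) \<le> length [0..<gdeg G u]"
    unfolding ports_def by (rule length_filter_le)
  ultimately show ?thesis by simp
qed

lemma wf_cutout: "wf_pgraph d (cutout M G D f)"
proof -
  let ?H = "cutout M G D f"
  have main: "gdeg ?H a \<le> d \<and> inj_on (gnbr ?H a) {..<gdeg ?H a}
     \<and> (\<forall>p<gdeg ?H a. gnbr ?H a p < M \<and> gnbr ?H a p \<noteq> a
        \<and> (\<exists>q<gdeg ?H (gnbr ?H a p). gnbr ?H (gnbr ?H a p) q = a))" for a
  proof (cases "a \<in> f ` halo G D")
    case True
    then obtain u where u: "u \<in> halo G D" "a = f u" by auto
    have ult: "u < gn G" using u halo_less by auto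
    have injG: "inj_on (gnbr G u) {..<gdeg G u}"
      using wf ult by (auto simp: wf_pgraph_def)
    have nth: "ports G D u ! p \<in> set (ports G D u)" if "p < length (ports G D u)" for p
      using that by simp
    have nb: "gnbr G u (ports G D u ! p) \<in> halo G D" if "p < length (ports G D u)" for p
      using nbr_in_halo[OF ult nth[OF that]] .
    have "inj_on (gnbr ?H a) {..<length (ports G D u)}"
    proof (rule inj_onI)
      fix p q assume p: "p \<in> {..<length (ports G D u)}" and q: "q \<in> {..<length (ports G D u)}"
        and "gnbr ?H a p = gnbr ?H a q"
      then have "f (gnbr G u (ports G D u ! p)) = f (gnbr G u (ports G D u ! q))"
        using u by (simp add: cutout_simps)
      then have "gnbr G u (ports G D u ! p) = gnbr G u (ports G D u ! q)"
        using inj_onD[OF inj] nb p q by blast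
      then have "ports G D u ! p = ports G D u ! q"
        using inj_onD[OF injG] ports_lt nth p q by blast
      moreover have "distinct (ports G D u)" by (simp add: ports_def)
      ultimately show "p = q" using p q by (simp add: nth_eq_iff_index_eq)
    qed
    moreover have "gnbr ?H a p < M \<and> gnbr ?H a p \<noteq> a
        \<and> (\<exists>q<gdeg ?H (gnbr ?H a p). gnbr ?H (gnbr ?H a p) q = a)" if p: "p < length (ports G D u)" for p
    proof -
      let ?p = "ports G D u ! p"
      let ?w = "gnbr G u ?p"
      have w: "?w \<in> halo G D" using nb[OF p] .
      have pG: "?p < gdeg G u" using ports_lt[OF nth[OF p]] .
      then obtain q where q: "q < gdeg G ?w" "gnbr G ?w q = u" and "?w \<noteq> u"
        using wf ult unfolding wf_pgraph_def by blast
      \<comment> \<open>A kept edge has an endpoint in \<open>D\<close>, so it survives in the port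
        list of the other endpoint too; this keeps the graph symmetric.\<close>
      have "u \<in> D \<or> ?w \<in> D" using nth[OF p] by (simp add: ports_def)
      then have "q \<in> set (ports G D ?w)" using q by (auto simp: ports_def)
      then obtain q' where q': "q' < length (ports G D ?w)" "ports G D ?w ! q' = q"
        by (auto simp: in_set_conv_nth)
      have eq: "gnbr ?H a p = f ?w" using u p by (simp add: cutout_simps)
      have "f ?w < M" using img w by auto
      moreover have "f ?w \<noteq> a" using inj_onD[OF inj _ w u(1)] \<open>?w \<noteq> u\<close> u(2) by blast
      moreover have "q' < gdeg ?H (f ?w)" "gnbr ?H (f ?w) q' = a"
        using w q' q u(2) by (simp_all add: cutout_simps)
      ultimately show ?thesis unfolding eq by blast
    qed
    moreover have "gdeg ?H a = length (ports G D u)" using u by (simp add: cutout_simps)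
    ultimately show ?thesis using length_ports[OF ult] by simp
  qed (simp add: cutout_simps)
  then show ?thesis unfolding wf_pgraph_def cutout_simps by blast
qed

lemma cutout_in_sparse_graphs:
  assumes "card (halo G D) \<le> m"
  shows "cutout M G D f \<in> sparse_graphs d M m"
proof -
  have "code G D f \<in> codes d M m"
    unfolding codes_def
  proof (intro CollectI conjI subsetI)
    show "length (code G D f) \<le> m"
      using assms by (simp add: code_def)
    fix e assume "e \<in> set (code G D f)"
    then obtain u where u: "u \<in> halo G D"
      and e: "e = (f u, map (\<lambda>p. (f (gnbr G u p), gin G u p)) (ports G D u))"
      using finite_halo by (auto simp: code_def)
    have "u < gn G" using u halo_less by auto
    then have "f (gnbr G u p) < M" if "p \<in> set (ports G D u)" for p
      using nbr_in_halo that img by blast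
    moreover have "f u < M" using u img by auto
    ultimately show "e \<in> {..<M} \<times> {l. set l \<subseteq> {..<M} \<times> UNIV \<and> length l \<le> d}"
      unfolding e using length_ports[OF \<open>u < gn G\<close>] by auto
  qed
  then show ?thesis using wf_cutout by (auto simp: sparse_graphs_def cutout_def)
qed

lemma ninfo_cutout: "u \<in> D \<Longrightarrow> ninfo (cutout M G D f) (f u) = (f u, snd (ninfo G u))"
  by (simp add: ninfo_def cutout_simps_D)

text \<open>A response contains the degree and the labels of the neighbour, which need not be
  preserved outside \<open>D\<close>; hence the condition \<open>w\<close>.\<close>

lemma probe_cutout:
  assumes u: "u \<in> D" and w: "p < gdeg G u \<Longrightarrow> gnbr G u p \<in> D"
  shows "probe (cutout M G D f) (f u) p = rename_resp f (probe G u p)"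
proof (cases "p < gdeg G u")
  case True
  let ?w = "gnbr G u p"
  have w: "?w \<in> D" using w True .
  have inhalo: "u \<in> halo G D" using u by (simp add: halo_def)
  have "f (gnbr G ?w q) = f u \<longleftrightarrow> gnbr G ?w q = u" if "q < gdeg G ?w" for q
  proof -
    have "gnbr G ?w q \<in> halo G D" using nbr_in_halo[of ?w q] that w D by (auto simp: ports_D)
    then show ?thesis using inj_on_eq_iff[OF inj _ inhalo] by simp
  qed
  then have "(q < gdeg G ?w \<and> gnbr (cutout M G D f) (f ?w) q = f u) = (q < gdeg G ?w \<and> gnbr G ?w q = u)" for q
    using w by (auto simp: cutout_simps_D)
  then have "backport (cutout M G D f) (f u) p = backport G u p"
    using u w True by (simp add: backport_def cutout_simps_D)
  moreover have "f u < M" "u < gn G" using img inhalo u D by auto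
  ultimately show ?thesis
    using True u w by (simp add: probe_def cutout_simps cutout_simps_D rename_resp_def ninfo_cutout case_prod_beta)
      (simp add: ninfo_def)
qed (simp add: probe_def cutout_simps_D u rename_resp_def)

end

section \<open>Isomorphic balls\<close>

lemma lg_iso_trans:
  assumes "lg_iso A B" "lg_iso B C"
  shows "lg_iso A C"
proof -
  obtain f where f: "bij_betw f (lverts A) (lverts B)" "ledges B = (\<lambda>e. f ` e) ` ledges A"
    "f (lcenter A) = lcenter B"
    "\<And>a e. a \<in> lverts A \<Longrightarrow> e \<in> ledges A \<Longrightarrow> a \<in> e \<Longrightarrow>
       lin B (f a) (f ` e) = lin A a e \<and> lout B (f a) (f ` e) = lout A a e"
    using assms(1) unfolding lg_iso_def by blast
  obtain g where g: "bij_betw g (lverts B) (lverts C)" "ledges C = (\<lambda>e. g ` e) ` ledges B"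
    "g (lcenter B) = lcenter C"
    "\<And>a e. a \<in> lverts B \<Longrightarrow> e \<in> ledges B \<Longrightarrow> a \<in> e \<Longrightarrow>
       lin C (g a) (g ` e) = lin B a e \<and> lout C (g a) (g ` e) = lout B a e"
    using assms(2) unfolding lg_iso_def by blast
  show ?thesis
    unfolding lg_iso_def
  proof (intro exI[of _ "g \<circ> f"] conjI ballI impI)
    show "bij_betw (g \<circ> f) (lverts A) (lverts C)" by (rule bij_betw_trans[OF f(1) g(1)])
    show "ledges C = (\<lambda>e. (g \<circ> f) ` e) ` ledges A" by (simp add: g(2) f(2) image_image image_comp)
    show "(g \<circ> f) (lcenter A) = lcenter C" by (simp add: f(3) g(3))
    fix a e assume a: "a \<in> lverts A" "e \<in> ledges A" "a \<in> e"
    have "f a \<in> lverts B" using f(1) a(1) by (auto simp: bij_betw_def)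
    moreover have "f ` e \<in> ledges B" "f a \<in> f ` e" using a f(2) by auto
    ultimately show "lin C ((g \<circ> f) a) ((g \<circ> f) ` e) = lin A a e" "lout C ((g \<circ> f) a) ((g \<circ> f) ` e) = lout A a e"
      using g(4)[of "f a" "f ` e"] f(4)[OF a] by (simp_all add: image_comp)
  qed
qed

lemma port_of_eq:
  assumes "inj_on (gnbr G a) {..<gdeg G a}" "p < gdeg G a"
  shows "port_of G a {a, gnbr G a p} = p"
  unfolding port_of_def
proof (rule the_equality)
  fix q assume "q < gdeg G a \<and> {a, gnbr G a q} = {a, gnbr G a p}"
  then have "q < gdeg G a" "gnbr G a q = gnbr G a p" by (auto simp: doubleton_eq_iff)
  then show "q = p" using assms by (auto dest: inj_onD)
qed (use assms in auto)

text \<open>Injectivity is asked beyond \<open>D\<close>: an edge of \<open>K\<close> at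
  \<open>f a\<close> comes from an edge of \<open>G\<close> from \<open>a\<close> to a node of the
  halo, which must be told apart from the other nodes of the ball.\<close>

lemma lg_iso_ball:
  fixes G K :: "'i pgraph" and g h :: "nat \<Rightarrow> nat \<Rightarrow> 'o"
  assumes wfG: "wf_pgraph d G" and wfK: "wf_pgraph d K"
    and v: "v < gn G" and inj: "inj_on f (halo G D)"
    and ball: "\<And>u. (v, u) \<in> near G ^^ r \<Longrightarrow> u \<in> D"
    and lt: "\<And>u. u \<in> D \<Longrightarrow> u < gn G \<and> f u < gn K"
    and deg: "\<And>u. u \<in> D \<Longrightarrow> gdeg K (f u) = gdeg G u"
    and nbr: "\<And>u p. u \<in> D \<Longrightarrow> p < gdeg G u \<Longrightarrow> gnbr K (f u) p = f (gnbr G u p)"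
    and gin: "\<And>u p. u \<in> D \<Longrightarrow> p < gdeg G u \<Longrightarrow> gin K (f u) p = gin G u p"
    and out: "\<And>u p. (v, u) \<in> near G ^^ r \<Longrightarrow> p < gdeg G u \<Longrightarrow> h (f u) p = g u p"
  shows "lg_iso (ball G r v g) (ball K r (f v) h)"
proof -
  let ?V = "{u. (v, u) \<in> near G ^^ r}"
  have verts: "lverts (ball G r x q) = {u. (x, u) \<in> near G ^^ r}" for G :: "'i pgraph" and x and q :: "nat \<Rightarrow> nat \<Rightarrow> 'o"
    by (simp add: ball_def Let_def near_pow_iff)
  have edges: "ledges (ball G r x q) = {{a, b} |a b. (x, a) \<in> near G ^^ r \<and> (x, b) \<in> near G ^^ r \<and> (a, b) \<in> adj G}"
    for G :: "'i pgraph" and x and q :: "nat \<Rightarrow> nat \<Rightarrow> 'o"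
    by (simp add: ball_def Let_def near_pow_iff)
  have adjK: "(f a, y) \<in> adj K \<longleftrightarrow> (\<exists>b. (a, b) \<in> adj G \<and> y = f b)" if "a \<in> D" for a y
    using lt[OF that] deg[OF that] nbr[OF that] by (auto simp: adj_def)
  have nearK: "(f a, y) \<in> near K \<longleftrightarrow> (\<exists>b. (a, b) \<in> near G \<and> y = f b)" if "a \<in> D" for a y
    unfolding near_def using adjK[OF that] by auto
  have halo: "b \<in> halo G D" if "a \<in> D" "(a, b) \<in> adj G" for a b
    using that by (auto simp: halo_def)
  have DH: "D \<subseteq> halo G D" by (auto simp: halo_def)
  \<comment> \<open>Balls correspond layer by layer. Before radius \<open>r\<close> all nodes lie in
    \<open>D\<close>, where \<open>f\<close> maps neighbourhoods onto neighbourhoods.\<close>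
  have pow: "(f v, y) \<in> near K ^^ k \<longleftrightarrow> (\<exists>u. (v, u) \<in> near G ^^ k \<and> y = f u)" if "k \<le> r" for k y
    using that
  proof (induction k arbitrary: y)
    case (Suc k)
    have inD: "u \<in> D" if "(v, u) \<in> near G ^^ k" for u
      using ball near_pow_mono[OF that, of r] Suc.prems by simp
    have "(f v, y) \<in> near K ^^ Suc k \<longleftrightarrow> (\<exists>u. (v, u) \<in> near G ^^ k \<and> (f u, y) \<in> near K)"
      using Suc by auto
    also have "\<dots> \<longleftrightarrow> (\<exists>u. (v, u) \<in> near G ^^ k \<and> (\<exists>w. (u, w) \<in> near G \<and> y = f w))"
      using inD nearK by blast
    also have "\<dots> \<longleftrightarrow> (\<exists>u. (v, u) \<in> near G ^^ Suc k \<and> y = f u)" by auto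
    finally show ?case .
  qed auto
  have vK: "{y. (f v, y) \<in> near K ^^ r} = f ` ?V" using pow[of r] by auto
  have VD: "?V \<subseteq> D" using ball by auto
  have eK: "(f a, f b) \<in> adj K \<longleftrightarrow> (a, b) \<in> adj G" if "a \<in> ?V" "b \<in> ?V" for a b
  proof -
    have "a \<in> D" "b \<in> D" using that VD by auto
    moreover have "f b = f y \<longleftrightarrow> b = y" if "(a, y) \<in> adj G" for y
      using inj_on_eq_iff[OF inj, of b y] halo[OF \<open>a \<in> D\<close> that] DH \<open>b \<in> D\<close> by blast
    ultimately show ?thesis unfolding adjK[OF \<open>a \<in> D\<close>] by auto
  qed
  show ?thesis
    unfolding lg_iso_def
  proof (intro exI[of _ f] conjI ballI impI)
    show "bij_betw f (lverts (ball G r v g)) (lverts (ball K r (f v) h))"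
      unfolding verts vK bij_betw_def using inj_on_subset[OF inj] VD DH by blast
    show "ledges (ball K r (f v) h) = (\<lambda>e. f ` e) ` ledges (ball G r v g)"
      unfolding edges
    proof (intro equalityI subsetI)
      fix e assume "e \<in> {{a, b} |a b. (f v, a) \<in> near K ^^ r \<and> (f v, b) \<in> near K ^^ r \<and> (a, b) \<in> adj K}"
      then obtain x y where xy: "e = {x, y}" "(f v, x) \<in> near K ^^ r" "(f v, y) \<in> near K ^^ r" "(x, y) \<in> adj K"
        by blast
      then obtain a b where ab: "a \<in> ?V" "b \<in> ?V" "x = f a" "y = f b"
        using pow[of r] by auto
      then have "e = f ` {a, b}" "(a, b) \<in> adj G" using eK xy by auto
      then show "e \<in> (\<lambda>e. f ` e) ` {{a, b} |a b. (v, a) \<in> near G ^^ r \<and> (v, b) \<in> near G ^^ r \<and> (a, b) \<in> adj G}"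
        using ab(1,2) by blast
    next
      fix e assume "e \<in> (\<lambda>e. f ` e) ` {{a, b} |a b. (v, a) \<in> near G ^^ r \<and> (v, b) \<in> near G ^^ r \<and> (a, b) \<in> adj G}"
      then obtain a b where ab: "e = f ` {a, b}" "a \<in> ?V" "b \<in> ?V" "(a, b) \<in> adj G" by blast
      then have "e = {f a, f b}" "(f a, f b) \<in> adj K" using eK by auto
      moreover have "(f v, f a) \<in> near K ^^ r" "(f v, f b) \<in> near K ^^ r"
        using pow[of r] ab(2,3) by auto
      ultimately show "e \<in> {{a, b} |a b. (f v, a) \<in> near K ^^ r \<and> (f v, b) \<in> near K ^^ r \<and> (a, b) \<in> adj K}"
        by blast
    qed
    show "f (lcenter (ball G r v g)) = lcenter (ball K r (f v) h)"
      by (simp add: ball_def Let_def)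
    fix a e
    assume a: "a \<in> lverts (ball G r v g)" and e: "e \<in> ledges (ball G r v g)" and "a \<in> e"
    then obtain x y where xy: "e = {x, y}" "a = x \<or> a = y" "(x, y) \<in> adj G"
      unfolding edges by blast
    then obtain b where b: "e = {a, b}" "(a, b) \<in> adj G"
      using sym_adj[OF wfG] by (metis insert_commute symD)
    then obtain p where p: "p < gdeg G a" "gnbr G a p = b" by (auto simp: adj_def)
    have "a \<in> ?V" using a by (simp add: verts)
    then have aD: "a \<in> D" using VD by blast
    have "port_of G a e = p"
      using port_of_eq[of G a p] p b wfG lt[OF aD] by (auto simp: wf_pgraph_def)
    moreover have "port_of K (f a) (f ` e) = p"
      using port_of_eq[of K "f a" p] p b wfK lt[OF aD] nbr[OF aD p(1)] deg[OF aD] by (auto simp: wf_pgraph_def)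
    ultimately show "lin (ball K r (f v) h) (f a) (f ` e) = lin (ball G r v g) a e"
        "lout (ball K r (f v) h) (f a) (f ` e) = lout (ball G r v g) a e"
      using gin[OF aD p(1)] out[of a p] \<open>a \<in> ?V\<close> p(1) by (simp_all add: ball_def Let_def)
  qed
qed

section \<open>Derandomization\<close>

text \<open>First moment: the expected number of failing events is at most
  \<open>\<epsilon> * card I\<close>, and some point does not exceed the expectation.\<close>

lemma (in prob_space) exists_point_few_bad_events:
  assumes "finite I" and E: "\<And>i. i \<in> I \<Longrightarrow> E i \<in> events" "\<And>i. i \<in> I \<Longrightarrow> prob (E i) \<ge> 1 - \<epsilon>"
  shows "\<exists>\<omega>\<in>space M. real (card {i \<in> I. \<omega> \<notin> E i}) \<le> \<epsilon> * card I"
proof (rule ccontr)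
  assume neg: "\<not> ?thesis"
  define X where "X = (\<lambda>\<omega>. \<Sum>i\<in>I. indicat_real (space M - E i) \<omega>)"
  have X: "X \<omega> = card {i \<in> I. \<omega> \<notin> E i}" if "\<omega> \<in> space M" for \<omega>
  proof -
    have "X \<omega> = (\<Sum>i\<in>I. of_bool (\<omega> \<notin> E i))"
      unfolding X_def using that by (intro sum.cong) (auto simp: indicator_def)
    then show ?thesis using \<open>finite I\<close> by (simp add: sum_of_bool_eq Int_def)
  qed
  have int: "integrable M X"
    unfolding X_def using E(1) by (intro Bochner_Integration.integrable_sum integrable_real_indicator) (auto simp: emeasure_eq_measure)
  have "AE \<omega> in M. \<epsilon> * card I < X \<omega>"
    using neg X by (intro AE_I2) (auto simp: not_le)
  then have "\<epsilon> * card I < expectation X"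
    by (rule expectation_greater[OF int])
  also have "expectation X = (\<Sum>i\<in>I. prob (space M - E i))"
    unfolding X_def using E(1) by (subst Bochner_Integration.integral_sum) (auto simp: emeasure_eq_measure)
  also have "\<dots> \<le> (\<Sum>i\<in>I. \<epsilon>)"
  proof (rule sum_mono)
    fix i assume "i \<in> I"
    with E[of i] show "prob (space M - E i) \<le> \<epsilon>" by (simp add: prob_compl)
  qed
  finally show False by simp
qed

text \<open>The union bound in counting form; the factor \<open>N\<close> on the left replaces a
  division on the right.\<close>

lemma card_UN_scaled_le:
  assumes "finite J" "\<And>i. i \<in> J \<Longrightarrow> card (B i) * N \<le> (c::nat)"
  shows "card (\<Union>i\<in>J. B i) * N \<le> card J * c"
proof -
  have "card (\<Union>i\<in>J. B i) * N \<le> (\<Sum>i\<in>J. card (B i)) * N"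
    using card_UN_le[OF assms(1)] by (rule mult_le_mono1)
  also have "\<dots> = (\<Sum>i\<in>J. card (B i) * N)" by (rule sum_distrib_right)
  also have "\<dots> \<le> (\<Sum>i\<in>J. c)" using assms(2) by (rule sum_mono)
  finally show ?thesis by simp
qed

text \<open>Resampling the value at \<open>b\<close>: if \<open>g\<close> does not look at \<open>\<pi> b\<close>, then a uniform \<open>\<pi>\<close>
  has \<open>\<pi> b = g \<pi>\<close> with probability at most \<open>1 / N\<close>.\<close>
lemma card_resample:
  fixes M N b :: nat
  defines "P \<equiv> {..<M} \<rightarrow>\<^sub>E {..<N}"
  assumes "B \<subseteq> P" "b < M" and eq: "\<And>\<pi>. \<pi> \<in> B \<Longrightarrow> \<pi> b = g \<pi>"
    and indep: "\<And>\<pi> y. \<pi> \<in> B \<Longrightarrow> g (\<pi>(b := y)) = g \<pi>"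
  shows "card B * N \<le> card P"
proof -
  have "inj_on (\<lambda>(\<pi>, y). \<pi>(b := y)) (B \<times> {..<N})"
  proof (intro inj_onI, clarify)
    fix \<pi>1 \<pi>2 :: "nat \<Rightarrow> nat" and y1 y2
    assume B: "\<pi>1 \<in> B" "\<pi>2 \<in> B" and upd: "\<pi>1(b := y1) = \<pi>2(b := y2)"
    have "y1 = y2" using fun_cong[OF upd, of b] by simp
    \<comment> \<open>\<open>g\<close> recovers the overwritten value: on the updated function it
      still returns the old value at \<open>b\<close>.\<close>
    have "\<pi>1 b = \<pi>2 b" using eq indep B upd by metis
    moreover have "\<pi>1 x = \<pi>2 x" if "x \<noteq> b" for x using fun_cong[OF upd, of x] that by simp
    ultimately show "\<pi>1 = \<pi>2 \<and> y1 = y2" using \<open>y1 = y2\<close> by (metis ext)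
  qed
  moreover have "\<pi>(b := y) \<in> P" if "\<pi> \<in> B" "y < N" for \<pi> y
  proof -
    have "\<pi> \<in> P" using assms(2) that(1) by blast
    then show ?thesis
      unfolding P_def using that(2) \<open>b < M\<close> by (simp add: PiE_iff extensional_def)
  qed
  then have "(\<lambda>(\<pi>, y). \<pi>(b := y)) ` (B \<times> {..<N}) \<subseteq> P" by auto
  moreover have "finite P" unfolding P_def by (intro finite_PiE) auto
  ultimately have "card (B \<times> {..<N}) \<le> card P" by (rule card_inj_on_le)
  then show ?thesis by (simp add: card_cartesian_product)
qed

text \<open>Only identifiers of seen nodes enter the state; this is the independence that
  \<open>card_resample\<close> asks for.\<close>

lemma sim_cong_seen:
  assumes "\<And>u. u \<in> seen S H \<pi> k a \<Longrightarrow> \<pi>' u = \<pi> u"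
  shows "sim S H \<pi>' k a = sim S H \<pi> k a"
  using assms
proof (induction k)
  case 0
  then show ?case by (simp add: sim_0 seen_0)
next
  case (Suc k)
  have IH: "sim S H \<pi>' k a = sim S H \<pi> k a"
    using Suc seen_Suc_mono by blast
  obtain xs h where st: "sim S H \<pi> k a = (xs, h)" by fastforce
  show ?case
  proof (cases "S h")
    case (Probe i p)
    show ?thesis
    proof (cases "find (\<lambda>y. snd y = i) xs")
      case (Some y)
      show ?thesis
      proof (cases "probe H (fst y) p")
        case (Some z)
        obtain q w info where z: "z = (q, w, info)" by (cases z) auto
        have "w \<in> seen S H \<pi> (Suc k) a"
          using \<open>find _ _ = Some y\<close> Some Probe by (simp add: seen_def sim_Suc st sim_step_def z)
        then have "\<pi>' w = \<pi> w" by (rule Suc.prems)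
        then show ?thesis
          using \<open>find _ _ = Some y\<close> Some Probe by (simp add: sim_Suc IH st sim_step_def z)
      qed (use Some Probe in \<open>simp add: sim_Suc IH st sim_step_def\<close>)
    qed (use Probe in \<open>simp add: sim_Suc IH st sim_step_def\<close>)
  qed (simp add: sim_Suc IH st sim_step_def)
qed

text \<open>The strategy depends on \<open>\<pi> a\<close>, but \<open>a\<close> is always seen, so
  \<open>b\<close> differs from \<open>a\<close>. Up to the far hit the simulation has not read
  \<open>\<pi> b\<close>, and the probe names it only by a lucky guess.\<close>

lemma card_far_hit:
  fixes M N a b :: nat and A :: "nat \<Rightarrow> ('i, 'o) strategy"
  assumes "b < M"
  shows "card {\<pi> \<in> {..<M} \<rightarrow>\<^sub>E {..<N}. far_hit (A (\<pi> a)) H \<pi> j a b} * N \<le> card ({..<M} \<rightarrow>\<^sub>E {..<N})"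
proof -
  define g where "g \<pi> = (case A (\<pi> a) (snd (sim (A (\<pi> a)) H \<pi> j a)) of Probe i p \<Rightarrow> i | Answer x \<Rightarrow> 0)" for \<pi>
  have "g (\<pi>(b := y)) = g \<pi>" if "far_hit (A (\<pi> a)) H \<pi> j a b" for \<pi> y
  proof -
    have b: "b \<notin> seen (A (\<pi> a)) H \<pi> j a" using that by (simp add: far_hit_def)
    then have "a \<noteq> b" using start_in_seen by metis
    moreover have "sim (A (\<pi> a)) H (\<pi>(b := y)) j a = sim (A (\<pi> a)) H \<pi> j a"
      using b by (intro sim_cong_seen) auto
    ultimately show ?thesis by (simp add: g_def)
  qed
  moreover have "\<pi> b = g \<pi>" if "far_hit (A (\<pi> a)) H \<pi> j a b" for \<pi>
    using that by (auto simp: far_hit_def g_def)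
  ultimately show ?thesis
    by (intro card_resample[where b = b and g = g]) (use assms in auto)
qed

lemma prob_space_coins: "prob_space coins"
  unfolding coins_def by (intro prob_space_PiM prob_space_measure_pmf)

text \<open>The coins \<open>\<omega>\<close> are fixed first: among the injections only few fail for \<open>\<omega>\<close>, since each fails with
  probability at most \<open>1 / N\<close>. The far probes are then avoided by the choice of \<open>\<pi>\<close> alone, so no
  measurability of the probes in \<open>\<omega>\<close> is needed.\<close>
lemma derandomize:
  fixes L :: "('i::finite, 'o::finite) lcl" and A :: "('i, 'o) rlca" and HH :: "'i pgraph set" and M N t :: nat
  defines "d \<equiv> lcl_delta L"
  assumes rs: "rand_solves L A T 1" and finHH: "finite HH"
    and HH: "\<And>H. H \<in> HH \<Longrightarrow> wf_pgraph d H \<and> gn H = M"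
    and N: "N \<ge> 2" and big: "card HH * (1 + M * d * t * M) + M * M < N"
  obtains \<omega> \<pi> where "\<pi> ` {..<M} \<subseteq> {..<N}" "inj_on \<pi> {..<M}"
    "\<And>H. H \<in> HH \<Longrightarrow> valid_solution L (push N \<pi> H)
        (\<lambda>v p. the (run (A N \<omega> (ninfo (push N \<pi> H) v) p) (push N \<pi> H) (T N) []))"
    "\<And>H a p j b. H \<in> HH \<Longrightarrow> a < M \<Longrightarrow> p < d \<Longrightarrow> j < t \<Longrightarrow> b < M \<Longrightarrow>
        \<not> far_hit (A N \<omega> (\<pi> a, snd (ninfo H a)) p) H \<pi> j a b"
proof -
  interpret prob_space coins by (rule prob_space_coins)
  define P where "P = {..<M} \<rightarrow>\<^sub>E {..<N}"
  define Q where "Q = {\<pi> \<in> P. inj_on \<pi> {..<M}}"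
  have finP: "finite P" unfolding P_def by (intro finite_PiE) auto
  have "card P = N ^ M" unfolding P_def by (simp add: card_PiE)
  then have Ppos: "card P > 0" using N by simp
  have Pimg: "\<pi> ` {..<M} \<subseteq> {..<N}" if "\<pi> \<in> P" for \<pi> using that by (auto simp: P_def)
  define valid where "valid = (\<lambda>\<pi> H \<omega>. valid_solution L (push N \<pi> H)
        (\<lambda>v p. the (run (A N \<omega> (ninfo (push N \<pi> H) v) p) (push N \<pi> H) (T N) [])))"
  define E where "E = (\<lambda>(\<pi>, H). {\<omega> \<in> space coins. valid \<pi> H \<omega>})"
  have prob: "prob (E (\<pi>, H)) \<ge> 1 - 1 / N" if "\<pi> \<in> Q" "H \<in> HH" for \<pi> H
  proof -
    have "wf_pgraph d (push N \<pi> H)"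
      by (rule wf_push) (use that HH Pimg in \<open>auto simp: Q_def\<close>)
    moreover have "gn (push N \<pi> H) = N" by (simp add: push_def Let_def)
    ultimately show ?thesis
      using rs N unfolding rand_solves_def E_def valid_def d_def by fastforce
  qed
  \<comment> \<open>The measure of a set outside the sigma-algebra is 0, so the positive lower bound
    forces measurability.\<close>
  have meas: "E (\<pi>, H) \<in> events" if "\<pi> \<in> Q" "H \<in> HH" for \<pi> H
  proof (rule ccontr)
    assume "E (\<pi>, H) \<notin> events"
    then have "prob (E (\<pi>, H)) = 0" by (rule measure_notin_sets)
    moreover have "1 - 1 / real N > 0" using N by simp
    ultimately show False using prob[OF that] by simp
  qed
  have "finite (Q \<times> HH)" using finP finHH by (simp add: Q_def)
  from exists_point_few_bad_events[OF this, of E "1 / N"] prob meas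
  obtain \<omega> where \<omega>: "\<omega> \<in> space coins"
    and few: "real (card {i \<in> Q \<times> HH. \<omega> \<notin> E i}) \<le> 1 / N * card (Q \<times> HH)" by blast
  \<comment> \<open>Three kinds of bad maps: some graph is solved wrongly, some probe is a far hit,
    two identifiers collide. Counting within all maps, with collisions as one more rare event, lets
    a single value be resampled freely.\<close>
  define B1 where "B1 = {\<pi> \<in> Q. \<exists>H\<in>HH. \<not> valid \<pi> H \<omega>}"
  define B2 where "B2 = (\<Union>(H, a, p, j, b)\<in>HH \<times> {..<M} \<times> {..<d} \<times> {..<t} \<times> {..<M}.
      {\<pi> \<in> P. far_hit (A N \<omega> (\<pi> a, snd (ninfo H a)) p) H \<pi> j a b})"
  define B3 where "B3 = (\<Union>(a, b)\<in>{..<M} \<times> {..<M}. {\<pi> \<in> P. a \<noteq> b \<and> \<pi> b = \<pi> a})"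
  have "card B1 * N \<le> card HH * card P"
  proof -
    have "B1 \<subseteq> fst ` {i \<in> Q \<times> HH. \<omega> \<notin> E i}" using \<omega> by (force simp: B1_def E_def)
    then have "card B1 \<le> card {i \<in> Q \<times> HH. \<omega> \<notin> E i}"
      using \<open>finite (Q \<times> HH)\<close> by (intro surj_card_le) auto
    then have "real (card B1) \<le> 1 / N * card (Q \<times> HH)" using few by linarith
    then have "real (card B1) * N \<le> real (card (Q \<times> HH))" using N by (simp add: field_simps)
    also have "card (Q \<times> HH) \<le> card P * card HH"
      using card_mono[OF finP, of Q] by (simp add: card_cartesian_product Q_def)
    finally have "real (card B1 * N) \<le> real (card P * card HH)" by simp
    then show ?thesis by (simp only: of_nat_le_iff mult.commute)
  qed
  moreover have "card B2 * N \<le> card (HH \<times> {..<M} \<times> {..<d} \<times> {..<t} \<times> {..<M}) * card P"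
    unfolding B2_def
    by (rule card_UN_scaled_le)
       (use finHH card_far_hit[where A = "\<lambda>x. A N \<omega> (x, snd (ninfo _ _)) _"] in \<open>auto simp: P_def\<close>)
  moreover have "card B3 * N \<le> card ({..<M} \<times> {..<M}) * card P"
    unfolding B3_def
  proof (rule card_UN_scaled_le, simp, clarify)
    fix a b assume "a < M" "b < M"
    show "card {\<pi> \<in> P. a \<noteq> b \<and> \<pi> b = \<pi> a} * N \<le> card P"
      unfolding P_def by (rule card_resample[where b = b and g = "\<lambda>\<pi>. \<pi> a"]) (use \<open>b < M\<close> in auto)
  qed
  ultimately have "(card B1 + card B2 + card B3) * N \<le> (card HH * (1 + M * d * t * M) + M * M) * card P"
    by (simp add: card_cartesian_product algebra_simps)
  also have "\<dots> < N * card P" using big Ppos by simp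
  finally have "card B1 + card B2 + card B3 < card P" by (simp add: mult.commute)
  moreover have "card (B1 \<union> B2 \<union> B3) \<le> card B1 + card B2 + card B3"
    using card_Un_le[of "B1 \<union> B2" B3] card_Un_le[of B1 B2] by linarith
  moreover have "finite (B1 \<union> B2 \<union> B3)"
    by (rule finite_subset[OF _ finP]) (auto simp: B1_def B2_def B3_def Q_def)
  ultimately have "\<not> P \<subseteq> B1 \<union> B2 \<union> B3" using card_mono by (metis leD le_less_trans)
  then obtain \<pi> where \<pi>: "\<pi> \<in> P" "\<pi> \<notin> B1" "\<pi> \<notin> B2" "\<pi> \<notin> B3" by blast
  have inj: "inj_on \<pi> {..<M}"
    using \<pi>(1,4) by (fastforce simp: B3_def inj_on_def)
  show thesis
  proof (rule that[of \<pi> \<omega>])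
    show "\<pi> ` {..<M} \<subseteq> {..<N}" using Pimg \<pi>(1) .
    show "inj_on \<pi> {..<M}" by (rule inj)
    show "valid_solution L (push N \<pi> H)
        (\<lambda>v p. the (run (A N \<omega> (ninfo (push N \<pi> H) v) p) (push N \<pi> H) (T N) []))" if "H \<in> HH" for H
      using \<pi>(1,2) inj that by (auto simp: B1_def Q_def valid_def)
    show "\<not> far_hit (A N \<omega> (\<pi> a, snd (ninfo H a)) p) H \<pi> j a b"
      if "H \<in> HH" "a < M" "p < d" "j < t" "b < M" for H a p j b
      using \<pi>(1,3) that unfolding B2_def by blast
  qed
qed

section \<open>The simulation is locally correct\<close>

text \<open>The algorithm is told that the graph has \<open>N\<close> nodes, whatever the true
  size.\<close>

definition sim_out :: "('i, 'o) dlca \<Rightarrow> nat \<Rightarrow> nat \<Rightarrow> (nat \<Rightarrow> nat) \<Rightarrow> 'i pgraph \<Rightarrow> 'i ninfo \<Rightarrow> nat \<Rightarrow> 'o" where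
  "sim_out A N t \<iota> G info p =
     (let S = A N (\<iota> (fst info), snd info) p in the (outcome S (snd (sim S G \<iota> t (fst info)))))"

text \<open>The labels around \<open>v\<close> depend only on \<open>D\<close>, whose halo is
  coloured injectively. Cutting it out gives a sparse graph \<open>H\<close>, on whose embedding
  \<open>K\<close> the algorithm is correct. The run on \<open>K\<close> and the simulations on
  \<open>H\<close> and on \<open>G\<close> agree, so the ball of \<open>v\<close> is isomorphic to a
  valid ball of \<open>K\<close>.\<close>

lemma sim_out_locally_valid:
  fixes L :: "('i::finite, 'o::finite) lcl" and A :: "('i, 'o) dlca" and G :: "'i pgraph" and M N t m :: nat
  defines "d \<equiv> lcl_delta L" and "r \<equiv> lcl_r L"
  assumes wf: "wf_pgraph d G" and v: "v < gn G"
    and col_less: "\<And>u. u < gn G \<Longrightarrow> col u < M"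
    and col_neq: "\<And>u w. u < gn G \<Longrightarrow> (u, w) \<in> near G ^^ (2 * (r + t + 1)) \<Longrightarrow> w \<noteq> u \<Longrightarrow> col u \<noteq> col w"
    and m: "m = Suc d ^ r * (1 + d * Suc t) * Suc d"
    and img: "\<pi> ` {..<M} \<subseteq> {..<N}" and inj: "inj_on \<pi> {..<M}"
    and valid: "\<And>H. H \<in> sparse_graphs d M m \<Longrightarrow> valid_solution L (push N \<pi> H)
        (\<lambda>v p. the (run (A N (ninfo (push N \<pi> H) v) p) (push N \<pi> H) t []))"
    and nofar: "\<And>H a p j b. H \<in> sparse_graphs d M m \<Longrightarrow> a < M \<Longrightarrow> p < d \<Longrightarrow> j < t \<Longrightarrow> b < M \<Longrightarrow>
        \<not> far_hit (A N (\<pi> a, snd (ninfo H a)) p) H \<pi> j a b"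
  shows "\<exists>B\<in>lcl_P L. lg_iso (ball G r v (\<lambda>u p. sim_out A N t (\<pi> \<circ> col) G (ninfo G u) p)) B"
proof -
  define S where "S u p = A N (\<pi> (col u), snd (ninfo G u)) p" for u p
  define V where "V = {u. (v, u) \<in> near G ^^ r}"
  \<comment> \<open>The ball together with everything explored to answer the queries in it;
    \<open>m\<close> bounds the size of its halo.\<close>
  define D where "D = (\<Union>u\<in>V. insert u (\<Union>p<d. seen (S u p) G (\<pi> \<circ> col) t u))"
  have finV: "finite V" and cardV: "card V \<le> Suc d ^ r"
    using card_near_pow[OF wf v] by (simp_all add: V_def)
  have "card D \<le> (\<Sum>u\<in>V. card (insert u (\<Union>p<d. seen (S u p) G (\<pi> \<circ> col) t u)))"
    unfolding D_def by (rule card_UN_le[OF finV])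
  also have "\<dots> \<le> (\<Sum>u\<in>V. 1 + d * Suc t)"
  proof (rule sum_mono)
    fix u
    have "card (\<Union>p<d. seen (S u p) G (\<pi> \<circ> col) t u) \<le> (\<Sum>p<d. card (seen (S u p) G (\<pi> \<circ> col) t u))"
      by (rule card_UN_le) simp
    also have "\<dots> \<le> (\<Sum>p<d. Suc t)" by (rule sum_mono) (rule card_seen)
    finally have "card (\<Union>p<d. seen (S u p) G (\<pi> \<circ> col) t u) \<le> d * Suc t" by simp
    moreover have "finite (\<Union>p<d. seen (S u p) G (\<pi> \<circ> col) t u)" using card_seen(1) by blast
    ultimately show "card (insert u (\<Union>p<d. seen (S u p) G (\<pi> \<circ> col) t u)) \<le> 1 + d * Suc t"
      by (simp add: card_insert_if)
  qed
  also have "\<dots> = card V * (1 + d * Suc t)" by simp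
  also have "\<dots> \<le> Suc d ^ r * (1 + d * Suc t)" using cardV by (rule mult_le_mono1)
  finally have cardD: "card D \<le> Suc d ^ r * (1 + d * Suc t)" .
  have VD: "V \<subseteq> D" by (auto simp: D_def)
  have Dnear: "(v, u) \<in> near G ^^ (r + t)" if "u \<in> D" for u
  proof -
    from that obtain w where w: "w \<in> V" and "u = w \<or> (\<exists>p. u \<in> seen (S w p) G (\<pi> \<circ> col) t w)"
      by (auto simp: D_def)
    then have "(w, u) \<in> near G ^^ t"
      using seen_near near_pow_mono[of w w 0 G t] by fastforce
    moreover have "(v, w) \<in> near G ^^ r" using w by (simp add: V_def)
    ultimately show ?thesis by (auto simp: relpow_add)
  qed
  have Dlt: "D \<subseteq> {..<gn G}" using Dnear near_pow_lt[OF wf _ v] by blast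
  have halo_near: "(v, u) \<in> near G ^^ (r + t + 1)" if "u \<in> halo G D" for u
  proof -
    obtain w where w: "w \<in> D" "(w, u) \<in> near G"
      using \<open>u \<in> halo G D\<close> by (auto simp: halo_def near_def)
    with relpow_Suc_I[OF Dnear[OF w(1)] w(2)] show ?thesis by simp
  qed
  have halo_lt: "u < gn G" if "u \<in> halo G D" for u
    using halo_near[OF that] near_pow_lt[OF wf _ v] by blast
  \<comment> \<open>Any two nodes of the halo are joined through \<open>v\<close>; this fixes the
    colouring radius.\<close>
  have "(x, y) \<in> near G ^^ (2 * (r + t + 1))" if "x \<in> halo G D" "y \<in> halo G D" for x y
    using sym_near_pow[OF wf halo_near[OF that(1)]] halo_near[OF that(2)]
    unfolding mult_2 relpow_add by blast
  then have injcol: "inj_on col (halo G D)"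
    using col_neq halo_lt by (intro inj_onI) metis
  have imgcol: "col ` halo G D \<subseteq> {..<M}" using col_less halo_lt by auto
  have haloD: "u \<in> halo G D" if "u \<in> D" for u using that by (simp add: halo_def)
  have colD: "col u < M" if "u \<in> D" for u using imgcol haloD[OF that] by auto
  note ctx = wf Dlt injcol imgcol
  define H where "H = cutout M G D col"
  have "card (halo G D) \<le> m"
    unfolding m using card_halo[OF ctx] cardD by (meson le_trans mult_le_mono1)
  then have H: "H \<in> sparse_graphs d M m"
    unfolding H_def by (rule cutout_in_sparse_graphs[OF ctx])
  have wfH: "wf_pgraph d H" and gnH: "gn H = M" using sparse_graphsD[OF H] by auto
  define K where "K = push N \<pi> H"
  have inj': "inj_on \<pi> {..<gn H}" and img': "\<pi> ` {..<gn H} \<subseteq> {..<N}"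
    using inj img by (simp_all add: gnH)
  note pctx = wfH inj' img'
  let ?f = "\<pi> \<circ> col"
  let ?h = "\<lambda>v p. the (run (A N (ninfo K v) p) K t [])"
  let ?g = "\<lambda>u p. sim_out A N t (\<pi> \<circ> col) G (ninfo G u) p"
  have fK: "?f u < gn K" if "u \<in> D" for u
    using colD[OF that] img by (auto simp: K_def push_simps[OF pctx])
  have out: "?h (?f u) p = ?g u p" if u: "u \<in> V" and p: "p < gdeg G u" for u p
  proof -
    have uD: "u \<in> D" using u VD by blast
    have "u < gn G" using Dlt uD by blast
    then have "gdeg G u \<le> d" using wf by (simp add: wf_pgraph_def)
    then have "p < d" using p by simp
    have info: "snd (ninfo H (col u)) = snd (ninfo G u)"
      unfolding H_def ninfo_cutout[OF ctx uD] by simp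
    have "ninfo K (?f u) = (\<pi> (col u), snd (ninfo G u))"
      unfolding K_def comp_def using ninfo_push[OF pctx, of "col u"] colD[OF uD] gnH info by simp
    then have "run (A N (ninfo K (?f u)) p) K t [] = run (S u p) K t []"
      by (simp add: S_def)
    also have "\<dots> = outcome (S u p) (snd (sim (S u p) H \<pi> t (col u)))"
      unfolding K_def
    proof (rule run_push_eq_sim[OF pctx])
      show "col u < gn H" using colD[OF uD] gnH by simp
      show "\<not> far_hit (S u p) H \<pi> j (col u) b" if "j < t" "b < gn H" for j b
        using nofar[OF H colD[OF uD] \<open>p < d\<close> that(1)] that(2) by (simp add: gnH S_def info)
    qed
    also have "sim (S u p) H \<pi> t (col u) = map_prod (map (apfst col)) id (sim (S u p) G ?f t u)"
    proof (rule sim_transfer[where D = D])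
      show "probe H (col w) q = rename_resp col (probe G w q)"
        if "w \<in> D" "q < gdeg G w \<Longrightarrow> gnbr G w q \<in> D" for w q
        unfolding H_def using probe_cutout[OF ctx that] .
      show "seen (S u p) G ?f t u \<subseteq> D" using u \<open>p < d\<close> by (auto simp: D_def)
    qed (use Dlt in auto)
    finally have "run (A N (ninfo K (?f u)) p) K t [] = outcome (S u p) (snd (sim (S u p) G ?f t u))"
      by simp
    moreover have "fst (ninfo G u) = u" by (simp add: ninfo_def)
    ultimately show ?thesis by (simp add: sim_out_def S_def Let_def)
  qed
  have "lg_iso (ball G r v ?g) (ball K r (?f v) ?h)"
  proof (rule lg_iso_ball[where D = D])
    show "wf_pgraph d G" by (rule wf)
    show "wf_pgraph d K" unfolding K_def by (rule wf_push[OF pctx])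
    show "v < gn G" by (rule v)
    show "inj_on ?f (halo G D)" using injcol inj imgcol inj_on_subset by (blast intro: comp_inj_on)
    show "u \<in> D" if "(v, u) \<in> near G ^^ r" for u using that VD by (auto simp: V_def)
    show "u < gn G \<and> ?f u < gn K" if "u \<in> D" for u using fK[OF that] Dlt that by auto
    show "gdeg K (?f u) = gdeg G u" if "u \<in> D" for u
      using colD[OF that] cutout_simps_D(1)[OF ctx that] gnH
      by (simp add: K_def push_simps[OF pctx]) (simp add: H_def)
    show "gnbr K (?f u) p = ?f (gnbr G u p)" if "u \<in> D" "p < gdeg G u" for u p
      using colD[OF that(1)] cutout_simps_D(2)[OF ctx that] gnH
      by (simp add: K_def push_simps[OF pctx]) (simp add: H_def)
    show "gin K (?f u) p = gin G u p" if "u \<in> D" "p < gdeg G u" for u p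
      using colD[OF that(1)] cutout_simps_D(3)[OF ctx that] gnH
      by (simp add: K_def push_simps[OF pctx]) (simp add: H_def)
    show "?h (?f u) p = ?g u p" if "(v, u) \<in> near G ^^ r" "p < gdeg G u" for u p
      using out that by (simp add: V_def)
  qed
  moreover have "\<exists>B\<in>lcl_P L. lg_iso (ball K r (?f v) ?h) B"
  proof -
    have "v \<in> V" using near_pow_mono[of v v 0 G r] by (simp add: V_def)
    then have "?f v < gn K" using fK VD by blast
    then show ?thesis
      using valid[OF H] unfolding valid_solution_def K_def r_def by blast
  qed
  ultimately show ?thesis using lg_iso_trans by blast
qed

section \<open>Choice of the size of the simulated graph\<close>

lemma power_add_power_le: "k \<ge> 1 \<Longrightarrow> p ^ k + q ^ k \<le> (p + q :: nat) ^ k"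
proof (induction k rule: dec_induct)
  case (step k)
  have "p ^ Suc k + q ^ Suc k \<le> p * (p ^ k + q ^ k) + q * (p ^ k + q ^ k)"
    by (simp add: algebra_simps)
  also have "\<dots> = (p + q) * (p ^ k + q ^ k)" by (simp add: algebra_simps)
  also have "\<dots> \<le> (p + q) * (p + q) ^ k" using step.IH by (rule mult_le_mono2)
  finally show ?case by simp
qed simp

text \<open>All quantities are of the form \<open>const ^ (t + 1)\<close>, except the number of sparse graphs, which has
  exponent of order \<open>(t + 1)\<^sup>2\<close>.\<close>
lemma size_bound:
  fixes d r c :: nat
  shows "\<exists>B\<ge>1. \<forall>t. let M = Suc d ^ (2 * (r + t + 1)); m = Suc d ^ r * (1 + d * Suc t) * Suc d in
    Suc (M * Suc (M * c) ^ d) ^ m * (1 + M * d * t * M) + M * M < B ^ ((Suc t)\<^sup>2)"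
proof -
  let ?D = "Suc d"
  \<comment> \<open>\<open>a ^ Suc t\<close> bounds \<open>M\<close>, \<open>b ^ Suc t\<close> the
    base in the count of sparse graphs, \<open>e * Suc t\<close> its exponent \<open>m\<close>, and
    \<open>f ^ Suc t\<close> the factor that comes from the far hits.\<close>
  define a where "a = ?D ^ (2 * r + 2)"
  define b where "b = 2 * (a * (a * Suc c) ^ d)"
  define e where "e = ?D ^ r * ?D * ?D"
  define f where "f = ?D * (a * 2 * a)"
  have a1: "a \<ge> 1" unfolding a_def by (rule one_le_power) simp
  have grow: "x ^ Suc t \<le> x ^ ((Suc t)\<^sup>2)" if "x \<ge> 1" for x t :: nat
    using that by (intro power_increasing) (auto simp: power2_eq_square)
  have "let M = Suc d ^ (2 * (r + t + 1)); m = Suc d ^ r * (1 + d * Suc t) * Suc d in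
    Suc (M * Suc (M * c) ^ d) ^ m * (1 + M * d * t * M) + M * M < (b ^ e * f + a * a + 1) ^ ((Suc t)\<^sup>2)" for t
  proof -
    let ?t = "Suc t"
    define M where "M = ?D ^ (2 * (r + t + 1))"
    define m where "m = ?D ^ r * (1 + d * ?t) * ?D"
    have M1: "M \<ge> 1" unfolding M_def by (rule one_le_power) simp
    have Ma: "M \<le> a ^ ?t"
      unfolding M_def a_def power_mult[symmetric] by (intro power_increasing) (auto simp: algebra_simps)
    have "Suc (M * c) \<le> M * Suc c" using M1 by simp
    also have "\<dots> \<le> a ^ ?t * Suc c ^ ?t" using Ma self_le_power[of "Suc c" ?t] by (intro mult_le_mono) auto
    finally have "Suc (M * c) \<le> (a * Suc c) ^ ?t" by (simp only: power_mult_distrib)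
    then have "Suc (M * c) ^ d \<le> ((a * Suc c) ^ ?t) ^ d" by (rule power_mono) simp
    also have "\<dots> = ((a * Suc c) ^ d) ^ ?t" by (simp only: power_mult[symmetric] mult.commute)
    finally have "M * Suc (M * c) ^ d \<le> a ^ ?t * ((a * Suc c) ^ d) ^ ?t"
      using Ma by (intro mult_le_mono)
    also have "\<dots> = (a * (a * Suc c) ^ d) ^ ?t" by (simp only: power_mult_distrib)
    finally have "Suc (M * Suc (M * c) ^ d) \<le> 1 ^ ?t + (a * (a * Suc c) ^ d) ^ ?t" by simp
    also have "\<dots> \<le> (1 + a * (a * Suc c) ^ d) ^ ?t" by (rule power_add_power_le) simp
    also have "\<dots> \<le> b ^ ?t" using a1 by (intro power_mono) (auto simp: b_def)
    finally have "Suc (M * Suc (M * c) ^ d) ^ m \<le> (b ^ ?t) ^ m" by (intro power_mono) auto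
    also have "\<dots> = b ^ (?t * m)" by (simp only: power_mult)
    also have "\<dots> \<le> b ^ (e * ?t\<^sup>2)"
    proof (rule power_increasing)
      have "1 + d * ?t \<le> ?D * ?t" by simp
      then have "m \<le> ?D ^ r * (?D * ?t) * ?D" unfolding m_def by (intro mult_le_mono) auto
      then have "m \<le> e * ?t" by (simp only: e_def mult_ac)
      then have "?t * m \<le> ?t * (e * ?t)" by (rule mult_le_mono2)
      then show "?t * m \<le> e * ?t\<^sup>2" by (simp only: power2_eq_square mult_ac)
      show "1 \<le> b" using a1 by (simp add: b_def)
    qed
    also have "\<dots> = (b ^ e) ^ ?t\<^sup>2" by (simp only: power_mult)
    finally have 1: "Suc (M * Suc (M * c) ^ d) ^ m \<le> (b ^ e) ^ ?t\<^sup>2" .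
    have "t \<le> 2 ^ ?t" using less_exp[of ?t] by simp
    then have "M * t * M \<le> a ^ ?t * 2 ^ ?t * a ^ ?t" using Ma by (intro mult_le_mono) auto
    then have Mt: "M * t * M \<le> (a * 2 * a) ^ ?t" by (simp only: power_mult_distrib)
    have "1 + M * d * t * M = 1 + d * (M * t * M)" by simp
    also have "\<dots> \<le> (a * 2 * a) ^ ?t + d * (a * 2 * a) ^ ?t"
      using Mt a1 by (intro add_mono mult_le_mono) auto
    also have "\<dots> = ?D * (a * 2 * a) ^ ?t" by simp
    also have "\<dots> \<le> ?D ^ ?t * (a * 2 * a) ^ ?t"
      using self_le_power[of ?D ?t] by (intro mult_le_mono1) auto
    also have "\<dots> = f ^ ?t" by (simp only: f_def power_mult_distrib)
    also have "\<dots> \<le> f ^ ?t\<^sup>2" using a1 by (intro grow) (simp add: f_def Suc_le_eq)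
    finally have 2: "1 + M * d * t * M \<le> f ^ ?t\<^sup>2" .
    have "M * M \<le> a ^ ?t * a ^ ?t" using Ma by (intro mult_le_mono)
    also have "\<dots> = (a * a) ^ ?t" by (simp only: power_mult_distrib)
    also have "\<dots> \<le> (a * a) ^ ?t\<^sup>2" using a1 by (intro grow) (simp add: Suc_le_eq)
    finally have 3: "M * M \<le> (a * a) ^ ?t\<^sup>2" .
    have "Suc (M * Suc (M * c) ^ d) ^ m * (1 + M * d * t * M) + M * M
      \<le> (b ^ e) ^ ?t\<^sup>2 * f ^ ?t\<^sup>2 + (a * a) ^ ?t\<^sup>2"
      using 1 2 3 by (intro add_mono mult_le_mono)
    also have "\<dots> = (b ^ e * f) ^ ?t\<^sup>2 + (a * a) ^ ?t\<^sup>2" by (simp only: power_mult_distrib)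
    also have "\<dots> \<le> (b ^ e * f + a * a) ^ ?t\<^sup>2" by (rule power_add_power_le) simp
    also have "\<dots> < (b ^ e * f + a * a + 1) ^ ?t\<^sup>2" by (rule power_strict_mono) auto
    finally show ?thesis unfolding Let_def M_def m_def .
  qed
  then show ?thesis by (intro exI[of _ "b ^ e * f + a * a + 1"]) auto
qed

lemma exists_size:
  fixes T :: "nat \<Rightarrow> nat" and B :: nat
  assumes small: "(\<lambda>n. real (T n)) \<in> o(\<lambda>n. sqrt (ln (real n)))" and B: "B \<ge> 1"
  shows "\<exists>N\<ge>2. B ^ ((Suc (T N))\<^sup>2) \<le> N"
proof -
  \<comment> \<open>Half of \<open>sqrt (ln N)\<close> pays for \<open>q * T N\<close>, the other
    half for \<open>q\<close> itself, so \<open>q * Suc (T N)\<close> is at most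
    \<open>sqrt (ln N)\<close>; squaring gives the claim. The added 1 keeps \<open>q\<close>
    positive when \<open>B = 1\<close>.\<close>
  define q where "q = sqrt (ln (real B) + 1)"
  have lnB: "ln (real B) \<ge> 0" using B by simp
  have q: "q > 0" "q\<^sup>2 = ln (real B) + 1" using lnB by (simp_all add: q_def add_nonneg_pos)
  have "\<forall>\<^sub>F n in at_top. norm (real (T n)) \<le> 1 / (2 * q) * norm (sqrt (ln (real n)))"
    using q by (intro landau_o.smallD[OF small]) simp
  moreover have "filterlim (\<lambda>n. sqrt (ln (real n))) at_top at_top"
    by (intro filterlim_compose[OF sqrt_at_top] filterlim_compose[OF ln_at_top] filterlim_real_sequentially)
  then have "\<forall>\<^sub>F n in at_top. sqrt (ln (real n)) \<ge> 2 * q"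
    by (simp add: filterlim_at_top)
  ultimately have "\<forall>\<^sub>F n in at_top. norm (real (T n)) \<le> 1 / (2 * q) * norm (sqrt (ln (real n)))
      \<and> sqrt (ln (real n)) \<ge> 2 * q \<and> n \<ge> 2"
    using eventually_ge_at_top[of 2] by eventually_elim auto
  then obtain N where N: "norm (real (T N)) \<le> 1 / (2 * q) * norm (sqrt (ln (real N)))"
      "sqrt (ln (real N)) \<ge> 2 * q" "N \<ge> 2"
    using eventually_happens'[OF sequentially_bot] by blast
  define s where "s = sqrt (ln (real N))"
  have s0: "s \<ge> 0" using N(3) by (simp add: s_def)
  have "2 * (q * real (T N)) \<le> s" "2 * q \<le> s"
    using N(1,2) q(1) s0 by (simp_all add: s_def field_simps)
  then have "q * real (Suc (T N)) \<le> s" by (simp add: algebra_simps)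
  then have "(q * real (Suc (T N)))\<^sup>2 \<le> s\<^sup>2" using q(1) by (intro power_mono) auto
  also have "s\<^sup>2 = ln (real N)" using N(3) by (simp add: s_def)
  finally have "(ln (real B) + 1) * (real (Suc (T N)))\<^sup>2 \<le> ln (real N)"
    by (simp only: power_mult_distrib q(2))
  moreover have "ln (real B) * (real (Suc (T N)))\<^sup>2 \<le> (ln (real B) + 1) * (real (Suc (T N)))\<^sup>2"
    by (intro mult_right_mono) auto
  ultimately have "real ((Suc (T N))\<^sup>2) * ln (real B) \<le> ln (real N)"
    by (simp only: of_nat_power mult.commute)
  then have "ln (real B ^ ((Suc (T N))\<^sup>2)) \<le> ln (real N)"
    using B by (simp add: ln_realpow)
  then have "real B ^ ((Suc (T N))\<^sup>2) \<le> real N"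
    using B N(3) by (subst (asm) ln_le_cancel_iff) auto
  then have "real (B ^ ((Suc (T N))\<^sup>2)) \<le> real N" by simp
  then have "B ^ ((Suc (T N))\<^sup>2) \<le> N" by (simp only: of_nat_le_iff)
  then show ?thesis using N(3) by blast
qed

section \<open>Assembly of the deterministic algorithm\<close>

theorem theorem2:
  fixes L :: "('i::finite, 'o::finite) lcl"
  assumes "lcl_wf L"
    and "\<forall>c::real. c > 0 \<longrightarrow>
           (\<exists>(A :: ('i, 'o) rlca) T. (\<lambda>n. real (T n)) \<in> o(\<lambda>n. sqrt (ln (real n)))
                  \<and> rand_solves L A T c)"
  shows "\<exists>(A :: ('i, 'o) dlca) T. (\<lambda>n. real (T n)) \<in> O(\<lambda>n. real (log_star n))
                  \<and> det_solves L A T"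
proof -
  define d where "d = lcl_delta L"
  define r where "r = lcl_r L"
  obtain RA :: "('i, 'o) rlca" and RT where small: "(\<lambda>n. real (RT n)) \<in> o(\<lambda>n. sqrt (ln (real n)))"
    and rs: "rand_solves L RA RT 1" using assms(2) zero_less_one by blast
  obtain B :: nat where B: "B \<ge> 1" and bound:
    "\<And>t. let M = Suc d ^ (2 * (r + t + 1)); m = Suc d ^ r * (1 + d * Suc t) * Suc d in
      Suc (M * Suc (M * CARD('i)) ^ d) ^ m * (1 + M * d * t * M) + M * M < B ^ ((Suc t)\<^sup>2)"
    using size_bound[of d r "CARD('i)"] by blast
  obtain N where N: "N \<ge> 2" "B ^ ((Suc (RT N))\<^sup>2) \<le> N" using exists_size[OF small B] by blast
  define t where "t = RT N"
  define R where "R = 2 * (r + t + 1)"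
  define M where "M = Suc d ^ R"
  define m where "m = Suc d ^ r * (1 + d * Suc t) * Suc d"
  define HH :: "'i pgraph set" where "HH = sparse_graphs d M m"
  have "card HH * (1 + M * d * t * M) + M * M
      \<le> Suc (M * Suc (M * CARD('i)) ^ d) ^ m * (1 + M * d * t * M) + M * M"
    unfolding HH_def by (intro add_mono mult_le_mono card_sparse_graphs order_refl)
  also have "\<dots> < B ^ ((Suc t)\<^sup>2)"
    using bound[of t] unfolding Let_def M_def m_def R_def .
  finally have big: "card HH * (1 + M * d * t * M) + M * M < N" using N(2) by (simp add: t_def)
  \<comment> \<open>\<open>N\<close>, \<open>t\<close>, \<open>M\<close>, \<open>\<omega>\<close>
    and \<open>\<pi>\<close> are all fixed before any input graph is given; the deterministic
    algorithm has them built in.\<close>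
  obtain \<omega> \<pi> where img: "\<pi> ` {..<M} \<subseteq> {..<N}" and inj: "inj_on \<pi> {..<M}"
    and valid: "\<And>H. H \<in> HH \<Longrightarrow> valid_solution L (push N \<pi> H)
        (\<lambda>v p. the (run (RA N \<omega> (ninfo (push N \<pi> H) v) p) (push N \<pi> H) (RT N) []))"
    and nofar: "\<And>H a p j b. H \<in> HH \<Longrightarrow> a < M \<Longrightarrow> p < d \<Longrightarrow> j < t \<Longrightarrow> b < M \<Longrightarrow>
        \<not> far_hit (RA N \<omega> (\<pi> a, snd (ninfo H a)) p) H \<pi> j a b"
    using derandomize[OF rs, of HH M N t] finite_sparse_graphs sparse_graphsD N(1) big
    unfolding HH_def d_def by metis
  \<comment> \<open>The size \<open>n\<close> is a parameter because a tree cannot read it off the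
    graph; for \<open>n = gn G\<close> this is \<open>\<pi> \<circ> dist_col d R G\<close>.\<close>
  define id_of where "id_of n G = \<pi> \<circ> greedy d R (log_star n) (16 ^ (Suc d ^ R)) G" for n and G :: "'i pgraph"
  define out where "out n info p G = sim_out (\<lambda>n. RA n \<omega>) N t (id_of n G) G info p"
    for n info p and G :: "'i pgraph"
  obtain C where C: "\<And>s v. computable (C * Suc s) (\<lambda>G :: 'i pgraph. greedy d R s (16 ^ (Suc d ^ R)) G v)"
    using computable_greedy by blast
  define c where "c n = C * Suc (log_star n)" for n
  \<comment> \<open>The strategy to be simulated depends on the identifier of the queried node, so
    this identifier is computed first, with \<open>c n\<close> probes; the simulation takes the
    rest.\<close>
  define T where "T n = c n + (c n + t * (1 + c n))" for n
  have "computable (T n) (out n info p)" for n info p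
  proof -
    have id: "computable (c n) (\<lambda>G. id_of n G u)" for u
      unfolding c_def id_of_def comp_def by (rule computable_comp[OF C])
    let ?S = "\<lambda>x. RA N \<omega> (x, snd info) p"
    have "computable (c n + t * (1 + c n))
        (\<lambda>G. the (outcome (?S x) (snd (sim (?S x) G (id_of n G) t (fst info)))))" for x
      by (rule computable_comp[OF computable_sim[OF id]])
    then have "computable (T n)
        (\<lambda>G. the (outcome (?S (id_of n G (fst info))) (snd (sim (?S (id_of n G (fst info))) G (id_of n G) t (fst info)))))"
      unfolding T_def
      by (rule computable_bind[OF id, where H = "\<lambda>x G. the (outcome (?S x) (snd (sim (?S x) G (id_of n G) t (fst info))))"])
    then show ?thesis by (simp add: out_def[abs_def] sim_out_def Let_def)
  qed
  then obtain P where P: "\<And>n info p G. exec (P n info p) G = out n info p G" "\<And>n info p G. cost (P n info p) G \<le> T n"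
    unfolding computable_def by metis
  define A :: "('i, 'o) dlca" where "A n info p = strat (P n info p)" for n info p
  have run: "run (A n info p) G (T n) [] = Some (out n info p G)" for n info p G
    unfolding A_def using run_strat P by metis
  have "det_solves L A T"
    unfolding det_solves_def
  proof (intro allI impI conjI)
    fix G :: "'i pgraph" assume wf: "wf_pgraph (lcl_delta L) G"
    show "run (A (gn G) (ninfo G v) p) G (T (gn G)) [] \<noteq> None" for v p by (simp add: run)
    show "valid_solution L G (\<lambda>v p. the (run (A (gn G) (ninfo G v) p) G (T (gn G)) []))"
      unfolding valid_solution_def run option.sel
    proof (intro allI impI)
      fix v assume v: "v < gn G"
      have "\<exists>B\<in>lcl_P L. lg_iso (ball G (lcl_r L) v
          (\<lambda>u p. sim_out (\<lambda>n. RA n \<omega>) N t (\<pi> \<circ> dist_col d R G) G (ninfo G u) p)) B"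
      proof (rule sim_out_locally_valid[OF wf v, where M = M and m = m])
        show "dist_col d R G u < M" if "u < gn G" for u
          unfolding M_def using dist_col_less[OF _ that] wf by (simp add: d_def)
        show "dist_col d R G u \<noteq> dist_col d R G w"
          if "u < gn G" "(u, w) \<in> near G ^^ (2 * (lcl_r L + t + 1))" "w \<noteq> u" for u w
          using dist_col_neq[of d G u w R] wf that by (simp add: d_def R_def r_def)
        show "m = Suc (lcl_delta L) ^ lcl_r L * (1 + lcl_delta L * Suc t) * Suc (lcl_delta L)"
          by (simp add: m_def d_def r_def)
        show "\<pi> ` {..<M} \<subseteq> {..<N}" "inj_on \<pi> {..<M}" by fact+
      qed (use valid nofar in \<open>simp_all add: HH_def d_def t_def\<close>)
      then show "\<exists>H\<in>lcl_P L. lg_iso (ball G (lcl_r L) v (\<lambda>v p. out (gn G) (ninfo G v) p G)) H"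
        by (simp add: out_def id_of_def dist_col_def)
    qed
  qed
  moreover have "(\<lambda>n. real (T n)) \<in> O(\<lambda>n. real (log_star n))"
  proof (rule bigoI)
    show "\<forall>\<^sub>F n in at_top. norm (real (T n)) \<le> real (2 * C * (2 + t) + t) * norm (real (log_star n))"
      using eventually_ge_at_top[of 2]
    proof eventually_elim
      case (elim n)
      then have "Suc (log_star n) \<le> 2 * log_star n" using log_star_pos by (simp add: Suc_le_eq)
      then have "c n \<le> C * (2 * log_star n)" unfolding c_def by (rule mult_le_mono2)
      then have "(2 + t) * c n \<le> (2 + t) * (C * (2 * log_star n))" by (rule mult_le_mono2)
      moreover have "t * 1 \<le> t * log_star n" using log_star_pos[OF elim] by (rule mult_le_mono2)
      moreover have "T n = (2 + t) * c n + t * 1" by (simp add: T_def algebra_simps)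
      ultimately have "T n \<le> (2 + t) * (C * (2 * log_star n)) + t * log_star n" by linarith
      then have "T n \<le> (2 * C * (2 + t) + t) * log_star n" by (simp add: algebra_simps)
      then show ?case by (simp only: norm_of_nat of_nat_mult[symmetric] of_nat_le_iff)
    qed
  qed
  ultimately show ?thesis by blast
qed

end
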